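(* Let $q$ be a prime power and $X\subseteq\mathbb{P}^2$ the Hermitian curve over $\mathbb{F}_{q^2}$. Fix three distinct non-collinear points $P_1,P_2,P_3\in X(\mathbb{F}_{q^2})$ and set $B:=X(\mathbb{F}_{q^2})\setminus\{P_1,P_2,P_3\}$. Fix an integer $d\ge5$ with $1\le d\le q-1$ and integers $a_1,a_2,a_3\in\{1,\dots,d\}$ such that $a_1+a_2+a_3\le 3d-5$ and $a_i=d$ for at most one index $i\in\{1,2,3\}$. Set $E:=a_1P_1+a_2P_2+a_3P_3$ and let $\mathcal{C}:=\mathcal{C}(B,d,-E)$. Then $\mathcal{C}$ has length $n=|B|=q^3-2$ and dimension $k=\binom{d+2}{2}-a_1-a_2-a_3$. For $i\in\{1,2,3\}$ let $L_i$ be the line spanned by $P_j$ and $P_h$, where $\{i,j,h\}=\{1,2,3\}$. Then $\mathcal{C}^\perp$ has minimum distance $d$, and its minimum-weight codewords are exactly those whose support consists of $d$ points of $B\cap L_i$ for some $i\in\{1,2,3\}$.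
   Context: $\mathbb{P}^2$ is the projective plane over $\mathbb{F}_{q^2}$ with coordinates $(x:y:z)$; the Hermitian curve $X$ is the plane curve with affine equation $y+y^q=x^{q+1}$ (smooth, degree $q+1$, with $q^3+1$ rational points). $E$ is viewed both as a divisor on $X$ and as a zero-dimensional subscheme of $\mathbb{P}^2$. $\mathcal{C}(B,d,-E)$ denotes the code obtained by evaluating $H^0(X,\mathcal{O}_X(d)(-E))$ (degree-$d$ forms on $X$ vanishing on the scheme $E$) at the points of $B$, after fixing a coordinate representative of each point; it is a linear subspace of $\mathbb{F}_{q^2}^{|B|}$ with coordinates indexed by $B$. $\mathcal{C}^\perp$ is the dual code with respect to the standard dot product; weight = number of nonzero coordinates; support = set of points of $B$ indexing nonzero coordinates; minimum distance = minimal weight of a nonzero codeword. *)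

theory Defs
  imports Main "HOL-Computational_Algebra.Polynomial" "HOL-Computational_Algebra.Primes" "HOL-Library.Function_Algebras"
begin

text \<open>Points of the projective plane over a field 'a are represented as the set of all
  nonzero coordinate vectors representing them (a punctured line through the origin).\<close>

type_synonym 'a ppoint = "('a \<times> 'a \<times> 'a) set"

definition proj_class :: "'a::field \<times> 'a \<times> 'a \<Rightarrow> 'a ppoint" where
  "proj_class v = (case v of (x,y,z) \<Rightarrow> {(c*x, c*y, c*z) | c. c \<noteq> 0})"

definition proj_points :: "'a::field ppoint set" where
  "proj_points = {proj_class v | v. v \<noteq> (0,0,0)}"

definition herm :: "nat \<Rightarrow> 'a::comm_ring_1 \<times> 'a \<times> 'a \<Rightarrow> 'a" where
  "herm q v = (case v of (x,y,z) \<Rightarrow> y * z^q + y^q * z - x^(q+1))"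

definition herm_points :: "nat \<Rightarrow> 'a::field ppoint set" where
  "herm_points q = {P \<in> proj_points. \<forall>v\<in>P. herm q v = 0}"

definition det3 :: "'a::comm_ring_1 \<times> 'a \<times> 'a \<Rightarrow> 'a \<times> 'a \<times> 'a \<Rightarrow> 'a \<times> 'a \<times> 'a \<Rightarrow> 'a" where
  "det3 u v w = (case u of (u1,u2,u3) \<Rightarrow> case v of (v1,v2,v3) \<Rightarrow> case w of (w1,w2,w3) \<Rightarrow>
     u1*(v2*w3 - v3*w2) - u2*(v1*w3 - v3*w1) + u3*(v1*w2 - v2*w1))"

definition collinear3 :: "'a::field ppoint \<Rightarrow> 'a ppoint \<Rightarrow> 'a ppoint \<Rightarrow> bool" where
  "collinear3 P Q R = (\<exists>u\<in>P. \<exists>v\<in>Q. \<exists>w\<in>R. det3 u v w = 0)"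

definition line_through :: "'a::field ppoint \<Rightarrow> 'a ppoint \<Rightarrow> 'a ppoint set" where
  "line_through P Q = {R \<in> proj_points. collinear3 P Q R}"

text \<open>Homogeneous forms of degree d in x,y,z: coefficient functions on exponent triples,
  supported on monomials of total degree d.\<close>

definition mon_deg :: "nat \<Rightarrow> (nat \<times> nat \<times> nat) set" where
  "mon_deg d = {(i,j,k). i + j + k = d}"

definition forms :: "nat \<Rightarrow> (nat \<times> nat \<times> nat \<Rightarrow> 'a::zero) set" where
  "forms d = {c. \<forall>m. c m \<noteq> 0 \<longrightarrow> m \<in> mon_deg d}"

definition form_eval :: "nat \<Rightarrow> (nat \<times> nat \<times> nat \<Rightarrow> 'a::comm_ring_1) \<Rightarrow> 'a \<times> 'a \<times> 'a \<Rightarrow> 'a" where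
  "form_eval d c v = (case v of (x,y,z) \<Rightarrow>
     (\<Sum>m\<in>mon_deg d. case m of (i,j,k) \<Rightarrow> c m * x^i * y^j * z^k))"

definition form_poly :: "nat \<Rightarrow> (nat \<times> nat \<times> nat \<Rightarrow> 'a::comm_ring_1)
    \<Rightarrow> 'a poly \<times> 'a poly \<times> 'a poly \<Rightarrow> 'a poly" where
  "form_poly d c g = (case g of (gx,gy,gz) \<Rightarrow>
     (\<Sum>m\<in>mon_deg d. case m of (i,j,k) \<Rightarrow> [:c m:] * gx^i * gy^j * gz^k))"

text \<open>A truncated arc of order a on X through P which is an immersion at t = 0:
  gamma(0) represents P, gamma'(0) is not proportional to gamma(0), and H(gamma) = 0 mod t^a.
  Since X is smooth at P, the images of all such arcs are the unique length-a curvilinear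
  subscheme of X supported at P, i.e. the divisor aP viewed as a subscheme of P^2.\<close>

definition arc_on_herm :: "nat \<Rightarrow> 'a::field ppoint \<Rightarrow> nat \<Rightarrow> 'a poly \<times> 'a poly \<times> 'a poly \<Rightarrow> bool" where
  "arc_on_herm q P a g = (case g of (gx,gy,gz) \<Rightarrow>
     (poly gx 0, poly gy 0, poly gz 0) \<in> P \<and>
     (let x0 = coeff gx 0; y0 = coeff gy 0; z0 = coeff gz 0;
          x1 = coeff gx 1; y1 = coeff gy 1; z1 = coeff gz 1 in
        (y0*z1 - z0*y1, z0*x1 - x0*z1, x0*y1 - y0*x1) \<noteq> (0,0,0)) \<and>
     monom 1 a dvd (gy * gz^q + gy^q * gz - gx^(q+1)))"

definition vanishes_on :: "nat \<Rightarrow> nat \<Rightarrow> (nat \<times> nat \<times> nat \<Rightarrow> 'a::field) \<Rightarrow> 'a ppoint \<Rightarrow> nat \<Rightarrow> bool" where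
  "vanishes_on q d c P a = (\<forall>g. arc_on_herm q P a g \<longrightarrow> monom 1 a dvd form_poly d c g)"

definition herm_code :: "nat \<Rightarrow> 'a::field ppoint set \<Rightarrow> ('a ppoint \<Rightarrow> 'a \<times> 'a \<times> 'a) \<Rightarrow> nat
    \<Rightarrow> ('a ppoint \<times> nat) list \<Rightarrow> ('a ppoint \<Rightarrow> 'a) set" where
  "herm_code q B rep d E =
     {(\<lambda>Q. if Q \<in> B then form_eval d c (rep Q) else 0) | c.
        c \<in> forms d \<and> (\<forall>(P,a)\<in>set E. vanishes_on q d c P a)}"

definition dual_code :: "'b set \<Rightarrow> ('b \<Rightarrow> 'a::field) set \<Rightarrow> ('b \<Rightarrow> 'a) set" where
  "dual_code B C = {w. (\<forall>Q. Q \<notin> B \<longrightarrow> w Q = 0) \<and> (\<forall>c\<in>C. (\<Sum>Q\<in>B. w Q * c Q) = 0)}"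

definition supp :: "'b set \<Rightarrow> ('b \<Rightarrow> 'a::zero) \<Rightarrow> 'b set" where
  "supp B w = {Q \<in> B. w Q \<noteq> 0}"

definition weight :: "'b set \<Rightarrow> ('b \<Rightarrow> 'a::zero) \<Rightarrow> nat" where
  "weight B w = card (supp B w)"

definition min_distance :: "'b set \<Rightarrow> ('b \<Rightarrow> 'a::zero) set \<Rightarrow> nat" where
  "min_distance B C = (LEAST n. \<exists>w\<in>C. w \<noteq> (\<lambda>_. 0) \<and> weight B w = n)"

definition code_dim :: "('b \<Rightarrow> 'a::field) set \<Rightarrow> nat" where
  "code_dim C = Vector_Spaces.vector_space.dim (\<lambda>s (f::'b \<Rightarrow> 'a) x. s * f x) C"

end

theory Submission
  imports Defs "HOL-Library.FuncSet"
begin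

text \<open>At a rational point \<open>P\<close> the curve meets its tangent line \<open>T\<close> to order \<open>q + 1\<close>, so for
  \<open>a < q\<close> the divisor \<open>a P\<close> is the length \<open>a\<close> subscheme of \<open>T\<close> at \<open>P\<close>, and \<open>T\<close> contains no other
  rational point of the curve. Peeling off the three tangent lines one after the other shows that
  \<open>E\<close> imposes independent conditions on forms of degree \<open>d\<close> and \<open>d - 1\<close>, which gives the dimension.

  Let \<open>S\<close> be the support of a dual word with \<open>|S| \<le> d\<close>. A form of degree \<open>d - 3\<close> times the three
  tangents vanishes on \<open>E\<close>; if \<open>S\<close> is not collinear, \<open>d - 3\<close> lines suffice to separate some point of
  \<open>S\<close> from the others, a contradiction. If \<open>S\<close> lies on a line \<open>R\<close>, any form of degree \<open>d\<close> that
  vanishes on \<open>E \<inter> R\<close> can be corrected by a multiple of \<open>R\<close> to vanish on \<open>E\<close>, so \<open>S\<close> together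
  with the \<open>P\<^sub>i\<close> on \<open>R\<close> must have at least \<open>d + 2\<close> points: this forces \<open>|S| = d\<close> and \<open>R = L\<^sub>i\<close>.\<close>

subsection \<open>Vectors in three coordinates\<close>

text \<open>The bounds on the \<open>a i\<close> come from peeling in degree \<open>d - 1\<close>,
  the degree of the cofactor of \<open>R\<close> in a correction. The three tangents leave forms of
  degrees \<open>d - 1\<close>, \<open>d - 2\<close>, \<open>d - 3\<close>, which realise jets of
  length up to \<open>d\<close>, \<open>d - 1\<close>, \<open>d - 2\<close>. A suitable order of the
  points exists because at most one multiplicity equals \<open>d\<close> and the bound on the sum
  leaves one that is at most \<open>d - 2\<close>.

  The number \<open>d + 2\<close>: a line \<open>R\<close> containing a point of \<open>S\<close> is
  tangent at no \<open>P\<^sub>i\<close>, so it meets \<open>E\<close> at \<open>P\<^sub>i\<close>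
  with multiplicity at most one. One line for each \<open>P\<^sub>i\<close> on \<open>R\<close> and
  one for each point of \<open>S\<close> other than a chosen \<open>x\<close> isolate
  \<open>x\<close>, and they fit into degree \<open>d\<close> unless \<open>|S|\<close> plus the
  number of \<open>P\<^sub>i\<close> on \<open>R\<close> is at least \<open>d + 2\<close>. At most
  two \<open>P\<^sub>i\<close> lie on \<open>R\<close>.

  Conversely, a form of degree \<open>d\<close> on a side has \<open>d + 1\<close> coefficients, and
  vanishing at the two vertices removes two of them, so \<open>d\<close> further points of the side
  carry a relation. The field being finite, such linear algebra is done by counting
  elements.\<close>

type_synonym 'a vec3 = "'a \<times> 'a \<times> 'a"

text \<open>Lines are coefficient vectors: \<open>dot3 l v = 0\<close> is incidence and
  \<open>cross3 u v\<close> is the line joining \<open>u\<close> and \<open>v\<close>. The ring is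
  kept general because the same operations are applied to vectors of polynomials, that is, to
  arcs.\<close>

fun dot3 :: "'a::comm_ring_1 vec3 \<Rightarrow> 'a vec3 \<Rightarrow> 'a" where
  "dot3 (a,b,c) (x,y,z) = a*x + b*y + c*z"

fun cross3 :: "'a::comm_ring_1 vec3 \<Rightarrow> 'a vec3 \<Rightarrow> 'a vec3" where
  "cross3 (a,b,c) (x,y,z) = (b*z - c*y, c*x - a*z, a*y - b*x)"

fun scale3 :: "'a::comm_ring_1 \<Rightarrow> 'a vec3 \<Rightarrow> 'a vec3" where
  "scale3 s (x,y,z) = (s*x, s*y, s*z)"

fun plus3 :: "'a::comm_ring_1 vec3 \<Rightarrow> 'a vec3 \<Rightarrow> 'a vec3" where
  "plus3 (a,b,c) (x,y,z) = (a+x, b+y, c+z)"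

lemma dot3_zero_left [simp]: "dot3 (0,0,0) v = 0"
  by (cases v) simp

lemma dot3_plus3: "dot3 l (plus3 u v) = dot3 l u + dot3 l v"
  by (cases l; cases u; cases v) (simp add: algebra_simps)

lemma dot3_scale3: "dot3 l (scale3 s v) = s * dot3 l v"
  by (cases l; cases v) (simp add: algebra_simps)

lemma dot3_scale3_left: "dot3 (scale3 s l) v = s * dot3 l v"
  by (cases l; cases v) (simp add: algebra_simps)

lemma dot3_commute: "dot3 u v = dot3 v u"
  by (cases u; cases v) (simp add: algebra_simps)

lemma det3_eq_dot3_cross3: "det3 u v w = dot3 (cross3 u v) w"
  by (cases u; cases v; cases w) (simp add: det3_def algebra_simps)

lemma det3_rotate: "det3 u v w = det3 v w u"
  by (cases u; cases v; cases w) (simp add: det3_def algebra_simps)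

lemma det3_swap: "det3 u v w = - det3 v u w"
  by (cases u; cases v; cases w) (simp add: det3_def algebra_simps)

lemma det3_same [simp]: "det3 u u w = 0" "det3 u w u = 0" "det3 w u u = 0"
  by (cases u; cases w; simp add: det3_def algebra_simps)+

lemma dot3_cross3_same [simp]: "dot3 (cross3 u v) u = 0" "dot3 (cross3 u v) v = 0"
  by (cases u; cases v; simp add: algebra_simps)+

lemma scale3_scale3: "scale3 s (scale3 t v) = scale3 (s * t) v"
  by (cases v) (simp add: algebra_simps)

lemma scale3_one [simp]: "scale3 1 v = v"
  by (cases v) simp

lemma det3_scale3:
  "det3 (scale3 s u) v w = s * det3 u v w"
  "det3 u (scale3 s v) w = s * det3 u v w"
  "det3 u v (scale3 s w) = s * det3 u v w"
  by (cases u; cases v; cases w; simp add: det3_def algebra_simps)+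

lemma det3_plus3:
  "det3 (plus3 u u') v w = det3 u v w + det3 u' v w"
  "det3 u (plus3 v v') w = det3 u v w + det3 u v' w"
  "det3 u v (plus3 w w') = det3 u v w + det3 u v w'"
  by (cases u; cases v; cases w; cases u'; cases v'; cases w'; simp add: det3_def algebra_simps)+

text \<open>Cramer's rule without division, so that it also expands a polynomial arc in a frame of
  constant vectors.\<close>

lemma cramer3:
  "scale3 (det3 u v w) g =
     plus3 (scale3 (det3 g v w) u) (plus3 (scale3 (det3 u g w) v) (scale3 (det3 u v g) w))"
  by (cases u; cases v; cases w; cases g) (simp add: det3_def algebra_simps)

lemma det3_dot3: "det3 u v w * dot3 l g =
    det3 g v w * dot3 l u + det3 u g w * dot3 l v + det3 u v g * dot3 l w"
  by (cases u; cases v; cases w; cases g; cases l) (simp add: det3_def algebra_simps)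

lemma det3_eq_0_if_common_normal:
  fixes n :: "'a::field vec3"
  assumes "n \<noteq> (0,0,0)" "dot3 n u = 0" "dot3 n v = 0" "dot3 n w = 0"
  shows "det3 u v w = 0"
proof (rule ccontr)
  assume D: "det3 u v w \<noteq> 0"
  have "dot3 n g = 0" for g
    using det3_dot3[of u v w n g] assms D by simp
  from this[of "(1,0,0)"] this[of "(0,1,0)"] this[of "(0,0,1)"] assms(1) show False
    by (cases n) simp
qed

lemma cross3_eq_0_parallel:
  fixes u v :: "'a::field vec3"
  assumes "cross3 u v = (0,0,0)" "u \<noteq> (0,0,0)" "v \<noteq> (0,0,0)"
  shows "\<exists>c. c \<noteq> 0 \<and> v = scale3 c u"
proof -
  obtain a b c x y z where uv: "u = (a,b,c)" "v = (x,y,z)" by (cases u; cases v)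
  have e: "b*z = c*y" "c*x = a*z" "a*y = b*x" using assms(1) by (auto simp: uv)
  consider "a \<noteq> 0" | "b \<noteq> 0" | "c \<noteq> 0" using assms(2) uv by auto
  then have "\<exists>s. v = scale3 s u"
  proof cases
    case 1
    have "y = x / a * b" using 1 e(3) by (simp add: field_simps)
    moreover have "z = x / a * c" using 1 e(2) by (simp add: field_simps)
    ultimately show ?thesis using 1 by (intro exI[of _ "x/a"]) (simp add: uv)
  next
    case 2
    have "x = y / b * a" using 2 e(3) by (simp add: field_simps)
    moreover have "z = y / b * c" using 2 e(1) by (simp add: field_simps)
    ultimately show ?thesis using 2 by (intro exI[of _ "y/b"]) (simp add: uv)
  next
    case 3
    have "x = z / c * a" using 3 e(2) by (simp add: field_simps)
    moreover have "y = z / c * b" using 3 e(1) by (simp add: field_simps)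
    ultimately show ?thesis using 3 by (intro exI[of _ "z/c"]) (simp add: uv)
  qed
  then obtain s where "v = scale3 s u" by blast
  moreover from this assms(3) have "s \<noteq> 0" by (auto simp: uv)
  ultimately show ?thesis by blast
qed

lemma cross3_cross3_normal:
  fixes m u v :: "'a::comm_ring_1 vec3"
  assumes "dot3 m u = 0" "dot3 m v = 0"
  shows "cross3 m (cross3 u v) = (0,0,0)"
proof -
  have "cross3 m (cross3 u v) = plus3 (scale3 (dot3 m v) u) (scale3 (- dot3 m u) v)"
    by (cases m; cases u; cases v) (simp add: algebra_simps)
  then show ?thesis using assms by (cases u; cases v) simp
qed

text \<open>Both normals are proportional to \<open>cross3 u v\<close>: two distinct points lie on
  only one line.\<close>

lemma common_normal_unique:
  fixes m n u v :: "'a::field vec3"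
  assumes "cross3 u v \<noteq> (0,0,0)" "m \<noteq> (0,0,0)" "n \<noteq> (0,0,0)"
    "dot3 m u = 0" "dot3 m v = 0" "dot3 n u = 0" "dot3 n v = 0"
  shows "\<exists>c. c \<noteq> 0 \<and> n = scale3 c m"
proof -
  obtain a where a: "a \<noteq> 0" "cross3 u v = scale3 a m"
    using cross3_eq_0_parallel[OF cross3_cross3_normal[of m u v]] assms by metis
  obtain b where b: "b \<noteq> 0" "cross3 u v = scale3 b n"
    using cross3_eq_0_parallel[OF cross3_cross3_normal[of n u v]] assms by metis
  have "n = scale3 (inverse b) (scale3 b n)" using b(1) by (simp add: scale3_scale3)
  also have "\<dots> = scale3 (inverse b * a) m" using a b by (metis scale3_scale3)
  finally show ?thesis using a b by (intro exI[of _ "inverse b * a"]) auto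
qed

lemma cross3_nonzero_extend:
  fixes u v :: "'a::field vec3"
  assumes "cross3 u v \<noteq> (0,0,0)"
  shows "\<exists>w. det3 u v w \<noteq> 0"
proof (rule ccontr)
  assume "\<not> ?thesis"
  then have "dot3 (cross3 u v) w = 0" for w by (metis det3_eq_dot3_cross3)
  from this[of "(1,0,0)"] this[of "(0,1,0)"] this[of "(0,0,1)"] assms show False
    by (cases "cross3 u v") simp
qed

lemma separating_line:
  fixes u v :: "'a::field vec3"
  assumes "cross3 u v \<noteq> (0,0,0)"
  shows "\<exists>l. dot3 l u = 0 \<and> dot3 l v \<noteq> 0"
proof -
  obtain w where "det3 u v w \<noteq> 0" using cross3_nonzero_extend[OF assms] by blast
  then have "dot3 (cross3 w u) v \<noteq> 0"
    by (metis det3_eq_dot3_cross3 det3_rotate)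
  then show ?thesis by (intro exI[of _ "cross3 w u"]) auto
qed

lemma nonvanishing_line:
  fixes v :: "'a::field vec3"
  assumes "v \<noteq> (0,0,0)"
  shows "\<exists>l. dot3 l v \<noteq> 0"
proof (rule ccontr)
  assume "\<not> ?thesis"
  then have "dot3 l v = 0" for l by blast
  from this[of "(1,0,0)"] this[of "(0,1,0)"] this[of "(0,0,1)"] assms show False
    by (cases v) simp
qed

subsection \<open>Projective points\<close>

lemma mem_proj_class: "w \<in> proj_class v \<longleftrightarrow> (\<exists>c. c \<noteq> 0 \<and> w = scale3 c v)"
  by (cases v) (auto simp: proj_class_def)

lemma proj_class_self: "v \<in> proj_class v"
  unfolding mem_proj_class by (intro exI[of _ 1]) simp

lemma proj_class_in_proj_points: "v \<noteq> (0,0,0) \<Longrightarrow> proj_class v \<in> proj_points"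
  unfolding proj_points_def by blast

lemma proj_class_eqI: "c \<noteq> 0 \<Longrightarrow> w = scale3 c v \<Longrightarrow> proj_class w = proj_class (v::'a::field vec3)"
proof -
  assume c: "c \<noteq> 0" "w = scale3 c v"
  have "v = scale3 (inverse c) w" using c by (simp add: scale3_scale3)
  then show ?thesis
    using c unfolding set_eq_iff mem_proj_class
    by (metis mult_eq_0_iff nonzero_imp_inverse_nonzero scale3_scale3)
qed

lemma proj_points_memD:
  assumes "P \<in> proj_points" "u \<in> (P::'a::field ppoint)"
  shows "u \<noteq> (0,0,0)" "P = proj_class u"
proof -
  obtain v where v: "v \<noteq> (0,0,0)" "P = proj_class v" using assms by (auto simp: proj_points_def)
  obtain c where c: "c \<noteq> 0" "u = scale3 c v" using assms v by (auto simp: mem_proj_class)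
  show "u \<noteq> (0,0,0)" using c v by (cases v) auto
  show "P = proj_class u" using c v proj_class_eqI by metis
qed

lemma proj_points_nonempty: "P \<in> proj_points \<Longrightarrow> \<exists>u. u \<in> (P::'a::field ppoint)"
  by (auto simp: proj_points_def mem_proj_class intro: exI[of _ 1])

lemma distinct_points_cross3:
  assumes "P \<in> proj_points" "Q \<in> proj_points" "P \<noteq> Q" "u \<in> P" "v \<in> (Q::'a::field ppoint)"
  shows "cross3 u v \<noteq> (0,0,0)"
  using cross3_eq_0_parallel proj_class_eqI assms proj_points_memD by metis

lemma collinear3_iff:
  assumes "P \<in> proj_points" "Q \<in> proj_points" "R \<in> proj_points"
    "u \<in> P" "v \<in> Q" "w \<in> (R::'a::field ppoint)"
  shows "collinear3 P Q R \<longleftrightarrow> det3 u v w = 0"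
proof
  assume "collinear3 P Q R"
  then obtain u' v' w' where *: "u' \<in> P" "v' \<in> Q" "w' \<in> R" "det3 u' v' w' = 0"
    by (auto simp: collinear3_def)
  then obtain a b c where "a \<noteq> 0" "b \<noteq> 0" "c \<noteq> 0" "u' = scale3 a u" "v' = scale3 b v" "w' = scale3 c w"
    using assms proj_points_memD mem_proj_class by metis
  with *(4) show "det3 u v w = 0" by (simp add: det3_scale3)
qed (use assms in \<open>auto simp: collinear3_def\<close>)

subsection \<open>Forms as polynomial maps\<close>

text \<open>\<open>arc3 u v\<close> is the straight arc \<open>u + t v\<close>. With points seen as
  constant arcs, evaluation at a point and restriction to an arc are values of one polynomial
  map.\<close>

fun const3 :: "'a::zero vec3 \<Rightarrow> 'a poly vec3" where
  "const3 (x,y,z) = ([:x:],[:y:],[:z:])"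

fun arc3 :: "'a::zero vec3 \<Rightarrow> 'a vec3 \<Rightarrow> 'a poly vec3" where
  "arc3 (x,y,z) (x',y',z') = ([:x,x':],[:y,y':],[:z,z':])"

lemma dot3_const3_const3: "dot3 (const3 l) (const3 v) = [:dot3 l (v::'a::comm_ring_1 vec3):]"
  by (cases l; cases v) simp

lemma dot3_const3_arc3: "dot3 (const3 l) (arc3 u v) = [:dot3 l u, dot3 l (v::'a::comm_ring_1 vec3):]"
  by (cases l; cases u; cases v) (simp add: algebra_simps)

lemma finite_mon_deg: "finite (mon_deg d)"
  by (rule finite_subset[of _ "{..d} \<times> {..d} \<times> {..d}"]) (auto simp: mon_deg_def)

lemma card_mon_deg: "card (mon_deg d) = (d + 2) choose 2"
proof -
  have "mon_deg d = (\<lambda>(i,j). (i, j, d - i - j)) ` (SIGMA i:{..d}. {..d - i})"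
  proof (intro equalityI subsetI)
    fix m assume "m \<in> mon_deg d"
    then obtain i j k where "m = (i,j,k)" "i + j + k = d" by (auto simp: mon_deg_def)
    then show "m \<in> (\<lambda>(i,j). (i, j, d - i - j)) ` (SIGMA i:{..d}. {..d - i})"
      by (intro image_eqI[of _ _ "(i,j)"]) auto
  qed (auto simp: mon_deg_def)
  moreover have "inj_on (\<lambda>(i,j). (i, j, d - i - j)) (SIGMA i:{..d}. {..d - i})"
    by (auto simp: inj_on_def)
  ultimately have "card (mon_deg d) = card (SIGMA i:{..d}. {..d - i})"
    by (simp add: card_image)
  also have "\<dots> = (\<Sum>i\<le>d. Suc (d - i))" by simp
  also have "\<dots> = (\<Sum>i\<le>d. Suc i)"
    by (rule sum.reindex_bij_witness[of _ "\<lambda>i. d - i" "\<lambda>i. d - i"]) auto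
  also have "\<dots> = (d + 2) choose 2"
  proof (induction d)
    case (Suc d)
    have "(Suc d + 2) choose 2 = Suc (Suc d) + ((d + 2) choose 2)"
      using binomial_Suc_Suc[of "d + 2" 1] by (simp add: numeral_2_eq_2)
    then show ?case using Suc by simp
  qed (simp add: numeral_2_eq_2)
  finally show ?thesis .
qed

lemma form_poly_const3: "form_poly d c (const3 v) = [:form_eval d c (v::'a::comm_ring_1 vec3):]"
proof -
  have pow: "[:x:] ^ n = [:x ^ n:]" for x :: 'a and n by (induction n) (auto simp: one_pCons)
  obtain x y z where v: "v = (x,y,z)" by (cases v)
  have "(\<Sum>m\<in>A. [:f m:]) = [:sum f A:]" for f :: "nat \<times> nat \<times> nat \<Rightarrow> 'a" and A
    by (induction A rule: infinite_finite_induct) auto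
  then show ?thesis
    by (simp add: form_poly_def form_eval_def v pow case_prod_unfold mult_ac)
qed

lemma form_eval_scale3: "form_eval d c (scale3 s v) = s ^ d * form_eval d c v"
proof -
  obtain x y z where v: "v = (x,y,z)" by (cases v)
  show ?thesis unfolding form_eval_def v
    by (auto simp: sum_distrib_left mon_deg_def power_mult_distrib power_add intro!: sum.cong)
qed

lemma form_poly_scale3: "form_poly d c (scale3 s v) = s ^ d * form_poly d c v"
proof -
  obtain x y z where v: "v = (x,y,z)" by (cases v)
  show ?thesis unfolding form_poly_def v
    by (auto simp: sum_distrib_left mon_deg_def power_mult_distrib power_add mult_ac intro!: sum.cong)
qed

fun pcompose3 :: "'a::comm_ring_1 poly vec3 \<Rightarrow> 'a poly \<Rightarrow> 'a poly vec3" where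
  "pcompose3 (x,y,z) s = (pcompose x s, pcompose y s, pcompose z s)"

lemma form_poly_pcompose3: "form_poly d c (pcompose3 g s) = pcompose (form_poly d c g) s"
proof -
  have pow: "pcompose (p ^ n) s = pcompose p s ^ n" for p :: "'a poly" and n
    by (induction n) (auto simp: pcompose_mult pcompose_1)
  obtain x y z where g: "g = (x,y,z)" by (cases g)
  show ?thesis unfolding form_poly_def g
    by (simp add: pcompose_sum pcompose_mult pow pcompose_smult case_prod_unfold)
qed

lemma form_poly_add: "form_poly d (\<lambda>m. c m + c' m) g = form_poly d c g + form_poly d c' g"
proof -
  obtain x y z where g: "g = (x,y,z)" by (cases g)
  have [simp]: "[:a + b:] = [:a:] + [:b:]" for a b :: 'a by simp
  show ?thesis unfolding form_poly_def g
    by (simp add: sum.distrib[symmetric] case_prod_unfold algebra_simps del: add_pCons)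
qed

lemma form_poly_minus: "form_poly d (\<lambda>m. - c m) g = - form_poly d c (g::'a::comm_ring_1 poly vec3)"
proof -
  obtain x y z where g: "g = (x,y,z)" by (cases g)
  have [simp]: "[:- b:] = - [:b:]" for b :: 'a by simp
  show ?thesis unfolding form_poly_def g
    by (simp add: sum_negf[symmetric] case_prod_unfold del: minus_pCons)
qed

lemma dvd_diff_mult:
  fixes m :: "'a::comm_ring_1"
  assumes "m dvd a - a'" "m dvd b - b'"
  shows "m dvd a * b - a' * b'"
proof -
  have "a * b - a' * b' = a * (b - b') + (a - a') * b'" by (simp add: algebra_simps)
  then show ?thesis using assms by (metis dvd_add dvd_mult dvd_mult2)
qed

lemma dvd_diff_power:
  fixes m :: "'a::comm_ring_1"
  assumes "m dvd a - a'"
  shows "m dvd a ^ n - a' ^ n"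
  by (induction n) (use assms dvd_diff_mult in auto)

lemma form_poly_cong:
  assumes "m dvd x - x'" "m dvd y - y'" "m dvd z - z'"
  shows "m dvd form_poly d c (x,y,z) - form_poly d c (x',y',z')"
  unfolding form_poly_def prod.case sum_subtractf[symmetric]
proof (intro dvd_sum)
  fix e
  show "m dvd (case e of (i,j,k) \<Rightarrow> [:c e:] * x^i * y^j * z^k) - (case e of (i,j,k) \<Rightarrow> [:c e:] * x'^i * y'^j * z'^k)"
    unfolding case_prod_unfold
    by (intro dvd_diff_mult dvd_diff_power assms) simp
qed

text \<open>Forms are handled as maps on polynomial vectors, so that sums and products are
  pointwise; coefficient functions reappear only where membership in \<open>forms d\<close>
  matters.\<close>

definition is_form :: "nat \<Rightarrow> ('a::comm_ring_1 poly vec3 \<Rightarrow> 'a poly) \<Rightarrow> bool" where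
  "is_form d F \<longleftrightarrow> (\<exists>c\<in>forms d. \<forall>g. F g = form_poly d c g)"

lemma is_form_monomial:
  assumes "i + j + k = d"
  shows "is_form d (\<lambda>(x,y,z). [:a:] * x^i * y^j * z^k :: 'a::comm_ring_1 poly)"
proof -
  have "(i,j,k) \<in> mon_deg d" using assms by (simp add: mon_deg_def)
  then have "form_poly d (\<lambda>m. if m = (i,j,k) then a else 0) g = (case g of (x,y,z) \<Rightarrow> [:a:] * x^i * y^j * z^k)"
    for g :: "'a poly vec3"
  proof -
    obtain x y z where g: "g = (x,y,z)" by (cases g)
    have "form_poly d (\<lambda>m. if m = (i,j,k) then a else 0) g =
        (\<Sum>m\<in>mon_deg d. if m = (i,j,k) then [:a:] * x^i * y^j * z^k else 0)"
      unfolding form_poly_def g by (auto intro!: sum.cong)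
    then show ?thesis using \<open>(i,j,k) \<in> mon_deg d\<close> by (simp add: sum.delta finite_mon_deg g)
  qed
  then show ?thesis unfolding is_form_def
    by (intro bexI[of _ "\<lambda>m. if m = (i,j,k) then a else 0"]) (use assms in \<open>auto simp: forms_def mon_deg_def\<close>)
qed

lemma is_form_add: "is_form d F \<Longrightarrow> is_form d G \<Longrightarrow> is_form d (\<lambda>g. F g + G g)"
  unfolding is_form_def
proof (elim bexE)
  fix c c' :: "nat \<times> nat \<times> nat \<Rightarrow> 'a"
  assume *: "c \<in> forms d" "c' \<in> forms d" "\<forall>g. F g = form_poly d c g" "\<forall>g. G g = form_poly d c' g"
  then have "(\<lambda>m. c m + c' m) \<in> forms d" 
    unfolding forms_def by clarsimp (metis add.right_neutral)
  then show "\<exists>c\<in>forms d. \<forall>g. F g + G g = form_poly d c g"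
    using * by (intro bexI[of _ "\<lambda>m. c m + c' m"]) (auto simp: form_poly_add)
qed

lemma is_form_minus: "is_form d F \<Longrightarrow> is_form d (\<lambda>g. - F g)"
  unfolding is_form_def
proof (elim bexE)
  fix c :: "nat \<times> nat \<times> nat \<Rightarrow> 'a"
  assume *: "c \<in> forms d" "\<forall>g. F g = form_poly d c g"
  then show "\<exists>c\<in>forms d. \<forall>g. - F g = form_poly d c g"
    by (intro bexI[of _ "\<lambda>m. - c m"]) (auto simp: form_poly_minus forms_def)
qed

lemma is_form_zero: "is_form d (\<lambda>g. 0)"
  unfolding is_form_def
  by (intro bexI[of _ "\<lambda>m. 0"]) (auto simp: forms_def form_poly_def)

lemma is_form_sum: "(\<And>i. i \<in> A \<Longrightarrow> is_form d (F i)) \<Longrightarrow> is_form d (\<lambda>g. \<Sum>i\<in>A. F i g)"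
  by (induction A rule: infinite_finite_induct) (auto simp: is_form_zero is_form_add)

text \<open>All products of forms below are built from linear factors, so no convolution of
  coefficients is needed: each monomial just splits into three.\<close>

lemma is_form_mult_linear:
  assumes "is_form d F"
  shows "is_form (Suc d) (\<lambda>g. dot3 (const3 l) g * F g)"
proof -
  obtain c where F: "\<And>g. F g = form_poly d c g" using assms by (auto simp: is_form_def)
  obtain a1 a2 a3 where l: "l = (a1,a2,a3)" by (cases l)
  let ?M = "\<lambda>m g. (case m of (i,j,k) \<Rightarrow> (\<lambda>(x,y,z). [:a1 * c m:] * x^(Suc i) * y^j * z^k) g
     + (\<lambda>(x,y,z). [:a2 * c m:] * x^i * y^Suc j * z^k) g + (\<lambda>(x,y,z). [:a3 * c m:] * x^i * y^j * z^Suc k) g)"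
  have "dot3 (const3 l) g * F g = (\<Sum>m\<in>mon_deg d. ?M m g)" for g
  proof -
    obtain x y z where g: "g = (x,y,z)" by (cases g)
    have [simp]: "[:a * b:] = [:a:] * [:b:]" for a b :: 'a by simp
    show ?thesis unfolding F form_poly_def g l
      by (auto simp: sum_distrib_left algebra_simps simp del: mult_pCons_left mult_pCons_right intro!: sum.cong)
  qed
  moreover have "is_form (Suc d) (\<lambda>g. \<Sum>m\<in>mon_deg d. ?M m g)"
  proof (intro is_form_sum)
    fix m assume "m \<in> mon_deg d"
    then obtain i j k where m: "m = (i,j,k)" "i + j + k = d" by (auto simp: mon_deg_def)
    show "is_form (Suc d) (?M m)"
      unfolding m(1) prod.case by (intro is_form_add is_form_monomial) (use m in auto)
  qed
  ultimately show ?thesis by simp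
qed

lemma is_form_const: "is_form 0 (\<lambda>g. [:a:])"
  using is_form_monomial[of 0 0 0 0 a] by (simp add: case_prod_unfold)

lemma is_form_prod_linear: "is_form (length ls) (\<lambda>g. \<Prod>l\<leftarrow>ls. dot3 (const3 l) g)"
  by (induction ls) (use is_form_const[of 1] in \<open>auto simp: one_pCons intro: is_form_mult_linear\<close>)

lemma form_poly_smult: "form_poly d (\<lambda>m. a * c m) g = [:a:] * form_poly d c (g::'a::comm_ring_1 poly vec3)"
proof -
  obtain x y z where g: "g = (x,y,z)" by (cases g)
  have [simp]: "[:a * b:] = [:a:] * [:b:]" for a b :: 'a by simp
  show ?thesis unfolding form_poly_def g
    by (auto simp: sum_distrib_left mult.assoc simp del: mult_pCons_left mult_pCons_right intro!: sum.cong)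
qed

lemma forms_smult: "c \<in> forms d \<Longrightarrow> (\<lambda>m. a * c m) \<in> forms d" for a :: "'a::comm_ring_1"
  unfolding forms_def by (auto dest!: mult_not_zero)

lemma is_form_smult: "is_form d F \<Longrightarrow> is_form d (\<lambda>g. [:a:] * F g)"
  unfolding is_form_def by (metis form_poly_smult forms_smult)

lemma poly_form_poly:
  "poly (form_poly d c (x,y,z)) t = form_eval d c (poly x t, poly y t, poly z t)"
  by (simp add: form_poly_def form_eval_def poly_sum case_prod_unfold mult_ac)

lemma poly_form_poly_arc3:
  "poly (form_poly d c (arc3 u v)) t = form_eval d c (plus3 (scale3 t v) u)"
  by (cases u; cases v) (simp add: poly_form_poly add.commute)

lemma coeff_mult_top:
  fixes p r :: "'a::comm_ring_1 poly"
  assumes "degree p \<le> m" "degree r \<le> n"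
  shows "coeff (p * r) (m + n) = coeff p m * coeff r n"
proof -
  have "coeff (p * r) (m + n) = (\<Sum>i\<le>m + n. coeff p i * coeff r (m + n - i))" by (rule coeff_mult)
  also have "\<dots> = (\<Sum>i\<in>{m}. coeff p i * coeff r (m + n - i))"
  proof (rule sum.mono_neutral_right)
    show "\<forall>i\<in>{..m + n} - {m}. coeff p i * coeff r (m + n - i) = 0"
    proof
      fix i assume i: "i \<in> {..m + n} - {m}"
      then consider "i > m" | "m + n - i > n" by force
      then show "coeff p i * coeff r (m + n - i) = 0"
        using assms by cases (auto simp: coeff_eq_0)
    qed
  qed auto
  finally show ?thesis by simp
qed

text \<open>In the parameter \<open>t\<close> the point \<open>v\<close> is the point at infinity of
  the line, hence its value is the leading coefficient.\<close>

lemma form_poly_arc3_top: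
  fixes u v :: "'a::comm_ring_1 vec3"
  shows "degree (form_poly d c (arc3 u v)) \<le> d" "coeff (form_poly d c (arc3 u v)) d = form_eval d c v"
proof -
  obtain x y z x' y' z' where uv: "u = (x,y,z)" "v = (x',y',z')" by (cases u; cases v)
  have pow: "degree ([:s,t:] ^ n) \<le> n" "coeff ([:s,t:] ^ n) n = t ^ n" for s t :: 'a and n
  proof (induction n)
    case (Suc n)
    { case 1
      have "degree [:s,t:] \<le> 1" by simp
      then show ?case
        unfolding power_Suc using degree_mult_le[of "[:s,t:]" "[:s,t:] ^ n"] Suc(1) by linarith }
    { case 2 show ?case
        using coeff_mult_top[of "[:s,t:]" 1 "[:s,t:] ^ n" n] Suc by simp }
  qed auto
  let ?M = "\<lambda>i j k. [:c (i,j,k):] * [:x,x':]^i * [:y,y':]^j * [:z,z':]^k"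
  have M1: "degree ([:e:] * [:x,x':]^i) \<le> i" for e i
    using pow(1)[of x x' i] by (simp add: order_trans[OF degree_smult_le])
  have M2: "degree ([:e:] * [:x,x':]^i * [:y,y':]^j) \<le> i + j" for e i j
    by (rule order_trans[OF degree_mult_le add_mono[OF M1 pow(1)]])
  have M3: "degree (?M i j k) \<le> i + j + k" for i j k
    by (rule order_trans[OF degree_mult_le add_mono[OF M2 pow(1)]])
  have C: "coeff (?M i j k) (i + j + k) = c (i,j,k) * x'^i * y'^j * z'^k" for i j k
    unfolding coeff_mult_top[OF M2 pow(1)] coeff_mult_top[OF M1 pow(1)] by (simp add: pow)
  show "degree (form_poly d c (arc3 u v)) \<le> d"
    unfolding form_poly_def uv arc3.simps prod.case
  proof (intro degree_sum_le finite_mon_deg)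
    fix m assume "m \<in> mon_deg d"
    then obtain i j k where "m = (i,j,k)" "d = i + j + k" by (auto simp: mon_deg_def)
    then show "degree (case m of (i,j,k) \<Rightarrow> [:c m:] * [:x,x':]^i * [:y,y':]^j * [:z,z':]^k) \<le> d"
      using M3[of i j k] by simp
  qed
  show "coeff (form_poly d c (arc3 u v)) d = form_eval d c v"
    unfolding form_poly_def form_eval_def uv arc3.simps prod.case coeff_sum
  proof (rule sum.cong[OF refl])
    fix m assume "m \<in> mon_deg d"
    then obtain i j k where "m = (i,j,k)" "d = i + j + k" by (auto simp: mon_deg_def)
    then show "coeff (case m of (i,j,k) \<Rightarrow> [:c m:] * [:x,x':]^i * [:y,y':]^j * [:z,z':]^k) d =
        (case m of (i,j,k) \<Rightarrow> c m * x'^i * y'^j * z'^k)"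
      using C[of i j k] by simp
  qed
qed

subsection \<open>Interpolation along straight arcs\<close>

text \<open>Truncated geometric series: after normalising the constant term, \<open>p\<close> is
  \<open>1 - w\<close> with \<open>w\<close> divisible by \<open>t\<close>.\<close>

lemma poly_unit_mod_monom:
  fixes p :: "'a::field poly"
  assumes "coeff p 0 \<noteq> 0"
  shows "\<exists>p'. monom 1 a dvd p * p' - 1"
proof -
  define s where "s = [:inverse (coeff p 0):]"
  define w where "w = 1 - p * s"
  have "coeff w 0 = 0" using assms by (simp add: w_def s_def coeff_mult)
  then have "monom 1 1 dvd w" by (simp add: monom_1_dvd_iff')
  then have "monom 1 1 ^ a dvd w ^ a" by (rule dvd_power_same)
  then have dv: "monom 1 a dvd w ^ a" by (simp add: monom_power)
  have "p * s = 1 - w" by (simp add: w_def)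
  then have "p * (s * (\<Sum>k<a. w ^ k)) - 1 = - (w ^ a)"
    by (simp add: one_diff_power_eq mult.assoc[symmetric])
      (metis add_diff_cancel_left' diff_diff_eq2 diff_minus_eq_add minus_diff_eq one_diff_power_eq)
  then show ?thesis using dv by (metis dvd_minus_iff)
qed

lemma monom_dvd_pcompose:
  fixes p s :: "'a::field poly"
  assumes "monom 1 a dvd p" "coeff s 0 = 0"
  shows "monom 1 a dvd pcompose p s"
proof -
  obtain r where "p = monom 1 1 ^ a * r" using assms by (auto simp: monom_power elim!: dvdE)
  moreover have "pcompose (monom 1 1 ^ n) s = s ^ n" for n
    by (induction n) (auto simp: pcompose_mult monom_Suc pcompose_pCons pcompose_1)
  ultimately have "pcompose p s = s ^ a * pcompose r s" by (simp add: pcompose_mult)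
  moreover have "monom 1 1 dvd s" using assms by (simp add: monom_1_dvd_iff')
  then have "monom 1 1 ^ a dvd s ^ a" by (rule dvd_power_same)
  ultimately show ?thesis by (simp add: monom_power dvd_mult2)
qed

text \<open>The linear forms \<open>l\<close> and \<open>m\<close> dual to the frame restrict to
  \<open>1\<close> and \<open>t\<close> on the arc. The products of \<open>e - k\<close> copies of
  \<open>l\<close> and \<open>k\<close> copies of \<open>m\<close> then give every power up to
  \<open>e\<close>, that is, \<open>e + 1\<close> jet coefficients.\<close>

lemma arc_interpolation:
  fixes u v w :: "'a::field vec3"
  assumes D: "det3 u v w \<noteq> 0" and a: "a \<le> Suc e"
  shows "\<exists>F. is_form e F \<and> monom 1 a dvd F (arc3 u v) - r"
proof -
  define D where "D = det3 u v w"
  define l where "l = scale3 (inverse D) (cross3 v w)"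
  define m where "m = scale3 (inverse D) (cross3 w u)"
  have rot: "det3 v w u = D" "det3 w u v = D" unfolding D_def by (metis det3_rotate)+
  have lm: "dot3 l u = 1" "dot3 l v = 0" "dot3 m u = 0" "dot3 m v = 1"
    using D rot unfolding l_def m_def dot3_scale3_left
    by (simp_all add: det3_eq_dot3_cross3[symmetric] D_def)
  define ls where "ls k = replicate (e - k) l @ replicate k m" for k
  define F where "F g = (\<Sum>k<a. [:coeff r k:] * (\<Prod>l\<leftarrow>ls k. dot3 (const3 l) g))" for g
  have len: "length (ls k) = e" if "k < a" for k using that a by (auto simp: ls_def)
  have "is_form e F"
    unfolding F_def using len by (intro is_form_sum is_form_smult) (metis is_form_prod_linear lessThan_iff)
  moreover have "F (arc3 u v) = (\<Sum>k<a. monom (coeff r k) k)"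
    unfolding F_def
  proof (rule sum.cong[OF refl])
    fix k
    have "[:0,1::'a:] ^ k = monom 1 k" by (metis monom_altdef smult_1_left)
    then show "[:coeff r k:] * (\<Prod>l\<leftarrow>ls k. dot3 (const3 l) (arc3 u v)) = monom (coeff r k) k"
      unfolding ls_def by (simp add: dot3_const3_arc3 lm one_pCons[symmetric] smult_monom)
  qed
  moreover have "monom 1 a dvd (\<Sum>k<a. monom (coeff r k) k) - r"
    by (simp add: monom_1_dvd_iff' coeff_sum)
  ultimately show ?thesis by metis
qed

text \<open>A form of degree \<open>e\<close> is built as \<open>f\<^sub>1 + m\<^sub>1 * (f\<^sub>2 + m\<^sub>2 * f\<^sub>3)\<close>: since the line \<open>m\<^sub>i\<close>
  contains the \<open>i\<close>-th arc and misses the base points of the later ones, each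
  correction leaves the earlier jets alone and can be divided by a unit.\<close>

lemma three_arc_interpolation:
  fixes u1 u2 u3 v1 v2 v3 w1 w2 w3 m1 m2 :: "'a::field vec3"
  assumes D: "det3 u1 v1 w1 \<noteq> 0" "det3 u2 v2 w2 \<noteq> 0" "det3 u3 v3 w3 \<noteq> 0"
    and m1: "dot3 m1 u1 = 0" "dot3 m1 v1 = 0" "dot3 m1 u2 \<noteq> 0" "dot3 m1 u3 \<noteq> 0"
    and m2: "dot3 m2 u2 = 0" "dot3 m2 v2 = 0" "dot3 m2 u3 \<noteq> 0"
    and e: "2 \<le> e" "a1 \<le> e + 1" "a2 \<le> e" "a3 \<le> e - 1"
  shows "\<exists>F. is_form e F \<and> monom 1 a1 dvd F (arc3 u1 v1) - r1
    \<and> monom 1 a2 dvd F (arc3 u2 v2) - r2 \<and> monom 1 a3 dvd F (arc3 u3 v3) - r3"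
proof -
  let ?g1 = "arc3 u1 v1" and ?g2 = "arc3 u2 v2" and ?g3 = "arc3 u3 v3"
  let ?L1 = "dot3 (const3 m1)" and ?L2 = "dot3 (const3 m2)"
  obtain f1 where f1: "is_form e f1" "monom 1 a1 dvd f1 ?g1 - r1"
    using arc_interpolation[OF D(1), of a1 e r1] e by auto
  obtain i2 where i2: "monom 1 a2 dvd ?L1 ?g2 * i2 - 1"
    using poly_unit_mod_monom[of "?L1 ?g2" a2] m1 by (auto simp: dot3_const3_arc3)
  obtain f2 where f2: "is_form (e - 1) f2" "monom 1 a2 dvd f2 ?g2 - i2 * (r2 - f1 ?g2)"
    using arc_interpolation[OF D(2), of a2 "e - 1" "i2 * (r2 - f1 ?g2)"] e by auto
  define F2 where "F2 g = f1 g + ?L1 g * f2 g" for g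
  obtain i3 where i3: "monom 1 a3 dvd (?L1 ?g3 * ?L2 ?g3) * i3 - 1"
    using poly_unit_mod_monom[of "?L1 ?g3 * ?L2 ?g3" a3] m1 m2
    by (auto simp: dot3_const3_arc3)
  obtain f3 where f3: "is_form (e - 2) f3" "monom 1 a3 dvd f3 ?g3 - i3 * (r3 - F2 ?g3)"
    using arc_interpolation[OF D(3), of a3 "e - 2" "i3 * (r3 - F2 ?g3)"] e
    by (metis Suc_1 Suc_diff_Suc Suc_le_lessD diff_Suc_1)
  define F where "F g = F2 g + ?L1 g * (?L2 g * f3 g)" for g
  have se: "Suc (e - 1) = e" "Suc (Suc (e - 2)) = e" using e by auto
  have "is_form e F2" unfolding F2_def
    using is_form_add[OF f1(1)] is_form_mult_linear[OF f2(1), of m1] se by simp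
  then have "is_form e F" unfolding F_def
    using is_form_add is_form_mult_linear[OF is_form_mult_linear[OF f3(1), of m2], of m1] se by simp
  moreover have "?L1 ?g1 = 0" "?L2 ?g2 = 0" using m1 m2 by (simp_all add: dot3_const3_arc3)
  then have F12: "F ?g1 = f1 ?g1" "F ?g2 = f1 ?g2 + ?L1 ?g2 * f2 ?g2" by (simp_all add: F_def F2_def)
  moreover have "monom 1 a2 dvd F ?g2 - r2"
  proof -
    have "F ?g2 - r2 = ?L1 ?g2 * (f2 ?g2 - i2 * (r2 - f1 ?g2)) + (?L1 ?g2 * i2 - 1) * (r2 - f1 ?g2)"
      unfolding F12 by (simp add: algebra_simps)
    then show ?thesis using f2(2) i2 by (metis dvd_add dvd_mult dvd_mult2)
  qed
  moreover have "monom 1 a3 dvd F ?g3 - r3"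
  proof -
    have "F ?g3 - r3 = (?L1 ?g3 * ?L2 ?g3) * (f3 ?g3 - i3 * (r3 - F2 ?g3))
        + (?L1 ?g3 * ?L2 ?g3 * i3 - 1) * (r3 - F2 ?g3)"
      unfolding F_def by (simp add: algebra_simps)
    then show ?thesis using f3(2) i3 by (metis dvd_add dvd_mult dvd_mult2)
  qed
  ultimately show ?thesis using f1(2) by auto
qed

subsection \<open>The Hermitian form over a field with \<open>q\<^sup>2\<close> elements\<close>

text \<open>Every nonempty fibre is a translate of the kernel. This count stands in for rank and
  nullity: it is applied to the trace, to jets of forms and to moments.\<close>

lemma card_additive_map:
  fixes f :: "'b::ab_group_add \<Rightarrow> 'c::ab_group_add"
  assumes fin: "finite A"
    and add: "\<And>x y. x \<in> A \<Longrightarrow> y \<in> A \<Longrightarrow> x + y \<in> A"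
    and diff: "\<And>x y. x \<in> A \<Longrightarrow> y \<in> A \<Longrightarrow> x - y \<in> A"
    and hom: "\<And>x y. x \<in> A \<Longrightarrow> y \<in> A \<Longrightarrow> f (x + y) = f x + f y"
  shows "card A = card (f ` A) * card {x\<in>A. f x = 0}"
proof -
  have fib: "card {x\<in>A. f x = b} = card {x\<in>A. f x = 0}" if b: "b \<in> f ` A" for b
  proof -
    obtain x0 where x0: "x0 \<in> A" "b = f x0" using b by auto
    have d: "f (x - x0) = f x - f x0" if "x \<in> A" for x
      using hom[OF diff[OF that x0(1)] x0(1)] by simp
    show ?thesis
      by (rule bij_betw_same_card[of "\<lambda>x. x - x0"], rule bij_betw_byWitness[where f' = "\<lambda>x. x + x0"])
        (use x0 add diff hom d in auto)
  qed
  have "card A = (\<Sum>x\<in>A. 1)" by simp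
  also have "\<dots> = (\<Sum>b\<in>f ` A. \<Sum>x\<in>{x\<in>A. f x = b}. 1)" by (rule sum.image_gen[OF fin])
  also have "\<dots> = (\<Sum>b\<in>f ` A. card {x\<in>A. f x = 0})" by (rule sum.cong) (auto simp: fib)
  finally show ?thesis by simp
qed

text \<open>The gradient of the curve at \<open>v\<close>, since derivatives of \<open>q\<close>-th
  powers vanish. As a function of two points, \<open>dot3 (tang q u) v\<close> is the Hermitian
  form: semilinear in \<open>u\<close>, linear in \<open>v\<close>.\<close>

definition tang :: "nat \<Rightarrow> 'a::comm_ring_1 vec3 \<Rightarrow> 'a vec3" where
  "tang q v = (case v of (x,y,z) \<Rightarrow> (- (x^q), z^q, y^q))"

lemma herm_eq_dot3_tang: "herm q v = dot3 (tang q v) v"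
  by (cases v) (simp add: herm_def tang_def algebra_simps)

lemma herm_scale3: "herm q (scale3 c v) = c ^ (q + 1) * herm q v"
  by (cases v) (simp add: herm_def algebra_simps power_mult_distrib)

lemma tang_scale3: "tang q (scale3 c v) = scale3 (c ^ q) (tang q v)"
  by (cases v) (simp add: tang_def power_mult_distrib)

lemma herm_points_iff:
  assumes "P \<in> proj_points" "u \<in> (P::'a::field ppoint)"
  shows "P \<in> herm_points q \<longleftrightarrow> herm q u = 0"
proof
  assume "herm q u = 0"
  then have "herm q v = 0" if "v \<in> P" for v
    using that proj_points_memD[OF assms] by (auto simp: mem_proj_class herm_scale3)
  then show "P \<in> herm_points q" using assms by (auto simp: herm_points_def)
qed (use assms in \<open>auto simp: herm_points_def\<close>)

locale hermitian_field =
  fixes q :: nat and ty :: "'a::{finite,field} itself"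
  assumes prime_power: "\<exists>p m. prime p \<and> m \<ge> 1 \<and> q = p ^ m"
    and card_field: "card (UNIV :: 'a set) = q ^ 2"
begin

lemma q_ge_2: "q \<ge> 2"
proof -
  obtain p m where "prime p" "m \<ge> 1" "q = p ^ m" using prime_power by blast
  then show ?thesis using prime_ge_2_nat[of p] self_le_power[of p m] by simp
qed

lemma char_power: "prime CHAR('a) \<and> (\<exists>m. q = CHAR('a) ^ m)"
proof -
  obtain p m where p: "prime p" "m \<ge> 1" "q = p ^ m" using prime_power by blast
  \<comment> \<open>Translation by \<open>1\<close> permutes the field, so its cardinality is zero
    in it.\<close>
  have "(\<Sum>x\<in>UNIV. x::'a) = (\<Sum>x\<in>UNIV. x + 1)"
    by (rule sum.reindex_bij_witness[of _ "\<lambda>x. x + 1" "\<lambda>x. x - 1"]) auto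
  then have "of_nat (card (UNIV :: 'a set)) = (0 :: 'a)" by (simp add: sum.distrib)
  then have "of_nat p = (0 :: 'a)" by (simp add: card_field p)
  then have "CHAR('a) dvd p" by (simp add: of_nat_eq_0_iff_char_dvd)
  then have "CHAR('a) = p" using p(1) CHAR_not_1' prime_nat_iff by (metis CHAR_not_1 One_nat_def)
  then show ?thesis using p by auto
qed

lemma frob_add: "(x + y) ^ q = x ^ q + (y::'a) ^ q"
  using freshmans_dream'[of q] char_power by blast

lemma frob_add_poly: "(x + y) ^ q = x ^ q + (y::'a poly) ^ q"
  using freshmans_dream'[of q, where 'a = "'a poly"] char_power by auto

lemma frob_minus: "(- x) ^ q = - ((x::'a) ^ q)"
  using frob_add[of x "- x"] q_ge_2 by (simp add: eq_neg_iff_add_eq_0 add.commute zero_power)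

lemma frob_diff: "(x - y) ^ q = x ^ q - (y::'a) ^ q"
  using frob_add[of x "- y"] by (simp add: frob_minus)

lemma frob_frob: "((x::'a) ^ q) ^ q = x"
proof (cases "x = 0")
  case False
  let ?U = "UNIV - {0::'a}"
  \<comment> \<open>Multiplication by \<open>x\<close> permutes the nonzero elements, which gives
    Fermat's identity.\<close>
  have "(\<Prod>y\<in>?U. x * y) = (\<Prod>y\<in>?U. y)"
    by (rule prod.reindex_bij_witness[of _ "\<lambda>y. y / x" "\<lambda>y. x * y"]) (use False in auto)
  then have "x ^ card ?U * \<Prod>?U = \<Prod>?U" by (simp add: prod.distrib)
  moreover have "\<Prod>?U \<noteq> 0" by simp
  ultimately have "x ^ card ?U = 1" by simp
  moreover have "Suc (card ?U) = q ^ 2" using card_field q_ge_2 by (simp add: card_Diff_singleton)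
  ultimately have "x ^ (q ^ 2) = x" by (metis mult.right_neutral power_Suc)
  then show ?thesis by (simp add: power_mult[symmetric] power2_eq_square)
qed (use q_ge_2 in simp)

lemma frob_inject: "(x::'a) ^ q = y ^ q \<Longrightarrow> x = y"
  by (metis frob_frob)

lemma frob_poly_mod: "monom 1 q dvd (p::'a poly) ^ q - [:coeff p 0 ^ q:]"
proof -
  have "[:x:] ^ n = [:x ^ n:]" for x :: 'a and n by (induction n) (auto simp: one_pCons)
  moreover obtain c r where p: "p = pCons c r" by (cases p)
  have "p = [:c:] + monom 1 1 * r" by (simp add: p monom_Suc)
  then have "p ^ q = [:c:] ^ q + (monom 1 1 * r) ^ q" using frob_add_poly by simp
  then have "p ^ q = [:c:] ^ q + monom 1 q * r ^ q"
    by (simp add: power_mult_distrib monom_power)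
  ultimately have "p ^ q - [:coeff p 0 ^ q:] = monom 1 q * r ^ q"
    by (simp add: p)
  then show ?thesis by simp
qed

lemma tang_plus3: "tang q (plus3 u v) = plus3 (tang q u) (tang q (v::'a vec3))"
  by (cases u; cases v) (simp add: tang_def frob_add)

lemma tang_conj: "dot3 (tang q u) v = dot3 (tang q v) (u::'a vec3) ^ q"
  by (cases u; cases v) (simp add: tang_def frob_add frob_diff frob_minus power_mult_distrib frob_frob)

lemma tang_inject: "tang q u = tang q v \<Longrightarrow> u = (v::'a vec3)"
  by (cases u; cases v) (auto simp: tang_def dest: frob_inject)

lemma tang_eq_0_iff: "tang q u = (0,0,0) \<longleftrightarrow> (u::'a vec3) = (0,0,0)"
  using q_ge_2 by (cases u) (auto simp: tang_def)

text \<open>If \<open>v\<close> were on the tangent at \<open>u\<close>, then by Hermitian symmetry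
  both tangents would be the line joining \<open>u\<close> and \<open>v\<close>; but the tangent
  line determines its point. So a tangent contains no second rational point.\<close>

lemma isotropic_tang_nonzero:
  fixes u v :: "'a vec3"
  assumes "herm q u = 0" "herm q v = 0" and uv: "cross3 u v \<noteq> (0,0,0)"
  shows "dot3 (tang q u) v \<noteq> 0"
proof
  assume uv0: "dot3 (tang q u) v = 0"
  then have vu0: "dot3 (tang q v) u = 0" using tang_conj[of v u] q_ge_2 by simp
  have "u \<noteq> (0,0,0)" "v \<noteq> (0,0,0)" using uv by (cases u; cases v; force)+
  then obtain c where c: "tang q v = scale3 c (tang q u)"
    using common_normal_unique[OF uv, of "tang q u" "tang q v"] assms uv0 vu0
    by (auto simp: herm_eq_dot3_tang tang_eq_0_iff)
  \<comment> \<open>\<open>c\<close> is the \<open>q\<close>-th power of \<open>c ^ q\<close>, so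
    the scalar can be moved inside \<open>tang\<close>.\<close>
  then have "tang q v = tang q (scale3 (c ^ q) u)" by (simp add: tang_scale3 frob_frob)
  then have "v = scale3 (c ^ q) u" by (rule tang_inject)
  then show False using uv by (cases u) (simp add: algebra_simps)
qed

text \<open>The trace has at most \<open>q\<close> zeros, and its values lie among the at most
  \<open>q\<close> fixed points of Frobenius. The product of the two numbers is
  \<open>q ^ 2\<close>, so both are \<open>q\<close> and the trace is onto the fixed points.\<close>

lemma card_trace_fibre:
  assumes "b ^ q = (b::'a)"
  shows "card {y::'a. y ^ q + y = b} = q"
proof -
  define T where "T y = y ^ q + y" for y :: 'a
  have pr: "card {y::'a. poly p y = 0} \<le> q" if "p = monom 1 q + [:0, s:]" for p s
  proof -
    have "coeff p q = 1" using that q_ge_2 by (simp add: coeff_pCons split: nat.split)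
    then have "p \<noteq> 0" by auto
    moreover have "degree p \<le> q" unfolding that
      by (rule degree_add_le) (use q_ge_2 in \<open>auto simp: degree_monom_le\<close>)
    ultimately show ?thesis using card_poly_roots_bound[of p] by linarith
  qed
  have K: "card {y. T y = 0} \<le> q"
    using pr[of "monom 1 q + [:0,1:]" 1] by (simp add: T_def poly_monom add.commute)
  have Fq: "card {b::'a. b ^ q = b} \<le> q"
    using pr[of "monom 1 q + [:0,-1:]" "-1"] by (simp add: poly_monom)
  have sub: "range T \<subseteq> {b. b ^ q = b}"
    by (auto simp: T_def frob_add frob_frob)
  then have R: "card (range T) \<le> card {b::'a. b ^ q = b}" by (intro card_mono) auto
  have "card (UNIV :: 'a set) = card (range T) * card {y\<in>UNIV. T y = 0}"
    by (rule card_additive_map) (auto simp: T_def frob_add)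
  then have eq: "q * q = card (range T) * card {y. T y = 0}"
    by (simp add: card_field power2_eq_square)
  have Rq: "card (range T) = q"
  proof (rule ccontr)
    assume "card (range T) \<noteq> q"
    then have "card (range T) < q" using R Fq by linarith
    then have "card (range T) * card {y. T y = 0} < q * q"
      using K q_ge_2 by (metis mult_le_mono2 mult_less_cancel2 not_less order_le_less_trans zero_less_iff_neq_zero not_numeral_le_zero)
    then show False using eq by simp
  qed
  then have K: "card {y. T y = 0} = q" using eq q_ge_2 by auto
  have "range T = {b. b ^ q = b}" by (rule card_subset_eq[OF _ sub]) (use Rq R Fq in auto)
  then obtain y0 where y0: "b = T y0" using assms by blast
  have "card {y. T y = b} = card {y. T y = 0}"
    by (rule bij_betw_same_card[of "\<lambda>y. y - y0"], rule bij_betw_byWitness[where f' = "\<lambda>x. x + y0"])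
      (auto simp: y0 T_def frob_add frob_diff algebra_simps)
  then show ?thesis using K by (simp add: T_def)
qed

lemma norm_frob: "((x::'a) ^ (q + 1)) ^ q = x ^ (q + 1)"
  by (simp add: power_mult_distrib frob_frob)

text \<open>The single point \<open>(0:1:0)\<close> at infinity, and \<open>q\<close> affine points
  over each of the \<open>q ^ 2\<close> values of \<open>x\<close>.\<close>

lemma card_herm_points: "card (herm_points q :: 'a ppoint set) = q ^ 3 + 1"
proof -
  define A where "A = (SIGMA x:(UNIV::'a set). {y. y ^ q + y = x ^ (q + 1)})"
  define f where "f = (\<lambda>(x,y). proj_class (x,y,1::'a))"
  have "card A = (\<Sum>x\<in>(UNIV::'a set). q)"
    unfolding A_def using card_trace_fibre[OF norm_frob] by (subst card_SigmaI) auto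
  then have cA: "card A = q ^ 3" by (simp add: card_field power2_eq_square power3_eq_cube)
  have inj: "inj_on f A"
  proof (rule inj_onI)
    fix a b assume "f a = f b"
    obtain x y x' y' where ab: "a = (x,y)" "b = (x',y')" by (cases a; cases b)
    have "(x,y,1) \<in> proj_class (x,y,1)" by (auto simp: mem_proj_class intro: exI[of _ 1])
    then have "(x,y,1) \<in> proj_class (x',y',1)" using \<open>f a = f b\<close> by (simp add: f_def ab)
    then show "a = b" by (auto simp: mem_proj_class ab)
  qed
  have hp: "proj_class u \<in> herm_points q \<longleftrightarrow> herm q u = 0" if "u \<noteq> (0,0,0)" for u :: "'a vec3"
    by (rule herm_points_iff[OF proj_class_in_proj_points[OF that] proj_class_self])
  have "herm_points q = insert (proj_class (0,1,0)) (f ` A)"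
  proof (intro equalityI subsetI)
    fix P :: "'a ppoint" assume P: "P \<in> herm_points q"
    then have "P \<in> proj_points" by (simp add: herm_points_def)
    then obtain u where u: "u \<in> P" "u \<noteq> (0,0,0)" "P = proj_class u"
      using proj_points_nonempty proj_points_memD by metis
    then have h: "herm q u = 0" using P hp by simp
    obtain x y z where xyz: "u = (x,y,z)" by (cases u)
    show "P \<in> insert (proj_class (0,1,0)) (f ` A)"
    proof (cases "z = 0")
      case True
      then have "x = 0" using h q_ge_2 by (simp add: herm_def xyz zero_power)
      then have "proj_class u = proj_class (0,1,0)"
        using u True by (intro proj_class_eqI[of y]) (auto simp: xyz)
      then show ?thesis using u by simp
    next
      case False
      then have e: "proj_class u = proj_class (x/z, y/z, 1)"
        by (intro proj_class_eqI[of z]) (auto simp: xyz)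
      then have "herm q (x/z, y/z, 1) = 0" using P u hp[of "(x/z, y/z, 1)"] by simp
      then have "(x/z, y/z) \<in> A" by (simp add: A_def herm_def algebra_simps)
      then show ?thesis using u e by (auto simp: f_def)
    qed
  next
    fix P assume "P \<in> insert (proj_class (0,1,0)) (f ` A)"
    then show "P \<in> herm_points q"
      using q_ge_2 by (auto simp: f_def A_def hp herm_def algebra_simps zero_power)
  qed
  moreover have "proj_class (0,1,0) \<notin> f ` A"
  proof
    assume "proj_class (0,1,0) \<in> f ` A"
    then obtain x y where "proj_class (0,1,0::'a) = proj_class (x,y,1)" by (auto simp: f_def)
    moreover have "(0,1,0) \<in> proj_class (0,1,0::'a)" by (auto simp: mem_proj_class intro: exI[of _ 1])
    ultimately show False by (simp add: mem_proj_class)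
  qed
  moreover have "finite A" by (simp add: A_def)
  ultimately show ?thesis using inj cA by (simp add: card_image)
qed

text \<open>For isotropic \<open>u\<close> and \<open>v\<close> only the cross terms of the
  Hermitian form remain, and they are the trace of \<open>s * b\<close> with \<open>b\<close>
  nonzero. The excluded \<open>s = 0\<close> is the point \<open>v\<close>.\<close>

lemma card_secant:
  fixes u v :: "'a vec3"
  assumes u: "herm q u = 0" and v: "herm q v = 0" and uv: "cross3 u v \<noteq> (0,0,0)"
  shows "card {s. s \<noteq> 0 \<and> herm q (plus3 (scale3 s u) v) = 0} = q - 1"
proof -
  define b where "b = dot3 (tang q v) u"
  have bq: "dot3 (tang q u) v = b ^ q" by (simp add: b_def tang_conj[of u v])
  then have b0: "b \<noteq> 0" using isotropic_tang_nonzero[OF assms] q_ge_2 by (metis zero_power not_numeral_le_zero gr0I)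
  have "dot3 (plus3 x y) z = dot3 x z + dot3 y z" for x y z :: "'a vec3"
    by (metis dot3_commute dot3_plus3)
  then have h: "herm q (plus3 (scale3 s u) v) = (s * b) ^ q + s * b" for s
    using u v bq by (simp add: herm_eq_dot3_tang tang_plus3 tang_scale3 dot3_plus3 dot3_scale3
        dot3_scale3_left b_def[symmetric] power_mult_distrib)
  have "card {s. s \<noteq> 0 \<and> herm q (plus3 (scale3 s u) v) = 0} = card ({y::'a. y ^ q + y = 0} - {0})"
    unfolding h
    by (rule bij_betw_same_card[of "\<lambda>s. s * b"], rule bij_betw_byWitness[where f' = "\<lambda>y. y / b"])
      (use b0 in auto)
  also have "\<dots> = q - 1"
    using card_trace_fibre[of 0] q_ge_2 by (subst card_Diff_singleton) auto
  finally show ?thesis .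
qed

end

subsection \<open>Vanishing on a multiple of a point\<close>

context hermitian_field
begin

lemma herm_poly_mod:
  fixes gx gy gz :: "'a poly"
  shows "monom 1 q dvd (gy * gz^q + gy^q * gz - gx^(q+1))
    - dot3 (const3 (tang q (coeff gx 0, coeff gy 0, coeff gz 0))) (gx,gy,gz)"
proof -
  let ?r = "\<lambda>p::'a poly. p ^ q - [:coeff p 0 ^ q:]"
  have "[:- x:] = - [:x:]" for x :: 'a by simp
  then have "(gy * gz^q + gy^q * gz - gx^(q+1))
    - dot3 (const3 (tang q (coeff gx 0, coeff gy 0, coeff gz 0))) (gx,gy,gz)
    = gy * ?r gz + ?r gy * gz - gx * ?r gx"
    by (simp add: tang_def algebra_simps del: minus_pCons mult_pCons_left mult_pCons_right)
  then show ?thesis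
    using frob_poly_mod by (metis dvd_add dvd_diff dvd_mult dvd_mult2)
qed

lemma monom_dvd_monom_le: "a \<le> b \<Longrightarrow> monom 1 a dvd (monom 1 b :: 'a poly)"
  by (simp add: monom_1_dvd_iff')

text \<open>Since \<open>q\<close>-th powers are constant modulo \<open>t\<^sup>q\<close>, the curve agrees with its tangent line to
  order at least \<open>q\<close>, so up to reparametrization every arc is the straight one.\<close>

lemma vanishes_on_iff:
  fixes u v w :: "'a vec3"
  assumes P: "P \<in> proj_points" "u \<in> P" and a: "a \<le> q"
    and u: "dot3 (tang q u) u = 0" and v: "dot3 (tang q u) v = 0"
    and w: "dot3 (tang q u) w \<noteq> 0" and D: "det3 u v w \<noteq> 0"
  shows "vanishes_on q d c P a \<longleftrightarrow> monom 1 a dvd form_poly d c (arc3 u v)"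
proof
  have aq: "monom 1 a dvd (monom 1 q :: 'a poly)" by (rule monom_dvd_monom_le[OF a])
  {
    obtain x y z x' y' z' where uv: "u = (x,y,z)" "v = (x',y',z')" by (cases u; cases v)
    have "cross3 u v \<noteq> (0,0,0)" using D by (auto simp: det3_eq_dot3_cross3)
    moreover have "dot3 (const3 (tang q u)) (arc3 u v) = 0" by (simp add: dot3_const3_arc3 u v)
    then have "monom 1 q dvd ([:y,y':] * [:z,z':]^q + [:y,y':]^q * [:z,z':] - [:x,x':]^(q+1))"
      using herm_poly_mod[of "[:y,y':]" "[:z,z':]" "[:x,x':]"]
      by (simp only: uv arc3.simps coeff_pCons_0 diff_0_right)
    then have "monom 1 a dvd ([:y,y':] * [:z,z':]^q + [:y,y':]^q * [:z,z':] - [:x,x':]^(q+1))"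
      by (rule dvd_trans[OF aq])
    ultimately have "arc_on_herm q P a (arc3 u v)"
      using P(2) unfolding arc_on_herm_def uv arc3.simps prod.case by (simp add: Let_def)
    moreover assume "vanishes_on q d c P a"
    ultimately show "monom 1 a dvd form_poly d c (arc3 u v)" unfolding vanishes_on_def by blast
  }
  assume van: "monom 1 a dvd form_poly d c (arc3 u v)"
  show "vanishes_on q d c P a"
    unfolding vanishes_on_def
  proof (intro allI impI)
    fix g :: "'a poly vec3" assume arc: "arc_on_herm q P a g"
    obtain gx gy gz where g: "g = (gx,gy,gz)" by (cases g)
    define g0 where "g0 = (coeff gx 0, coeff gy 0, coeff gz 0)"
    have "g0 \<in> P" and h: "monom 1 a dvd (gy * gz^q + gy^q * gz - gx^(q+1))"
      using arc by (auto simp: arc_on_herm_def g g0_def poly_0_coeff_0)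
    then obtain s where s: "s \<noteq> 0" "g0 = scale3 s u"
      using proj_points_memD(2)[OF P] by (auto simp: mem_proj_class)
    let ?U = "const3 u" and ?V = "const3 v" and ?W = "const3 w" and ?L = "const3 (tang q u)"
    have "dot3 (const3 (tang q g0)) g = [:s ^ q:] * dot3 ?L g"
      by (cases "tang q u") (simp add: s tang_scale3 g algebra_simps smult_add_right)
    moreover have "monom 1 a dvd dot3 (const3 (tang q g0)) g"
    proof -
      have "A - (A - B) = B" for A B :: "'a poly" by simp
      then show ?thesis
        using dvd_diff[OF h dvd_trans[OF aq herm_poly_mod[of gy gz gx]]] unfolding g g0_def by (simp only:)
    qed
    ultimately have L: "monom 1 a dvd dot3 ?L g" using s(1) by (simp add: dvd_smult_iff)
    have LU: "dot3 ?L ?U = 0" "dot3 ?L ?V = 0" "dot3 ?L ?W = [:dot3 (tang q u) w:]"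
      using u v by (simp_all add: dot3_const3_const3)
    have DD: "det3 ?U ?V ?W = [:det3 u v w:]"
      by (cases u; cases v; cases w) (simp add: det3_def algebra_simps)
    \<comment> \<open>Pairing Cramer's rule with the tangent kills the \<open>u\<close> and
      \<open>v\<close> parts, so the \<open>w\<close> component of \<open>g\<close> is divisible by
      \<open>t ^ a\<close>.\<close>
    have "[:det3 u v w:] * dot3 ?L g = det3 ?U ?V g * [:dot3 (tang q u) w:]"
      using det3_dot3[of ?U ?V ?W ?L g] by (simp only: LU DD mult_zero_right add_0_left)
    then have "monom 1 a dvd det3 ?U ?V g * [:dot3 (tang q u) w:]"
      using dvd_mult[OF L] by metis
    then have dW: "monom 1 a dvd det3 ?U ?V g" using w by (simp add: dvd_smult_iff)
    define i where "i = [:inverse (det3 u v w):]"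
    have i: "i * [:det3 u v w:] = 1" using D by (simp add: i_def one_pCons)
    define \<alpha> where "\<alpha> = i * det3 g ?V ?W"
    define \<beta> where "\<beta> = i * det3 ?U g ?W"
    define \<gamma> where "\<gamma> = i * det3 ?U ?V g"
    have g_dec: "g = plus3 (scale3 \<alpha> ?U) (plus3 (scale3 \<beta> ?V) (scale3 \<gamma> ?W))"
    proof -
      have "g = scale3 i (scale3 (det3 ?U ?V ?W) g)" by (simp only: DD scale3_scale3 i scale3_one)
      also have "\<dots> = plus3 (scale3 \<alpha> ?U) (plus3 (scale3 \<beta> ?V) (scale3 \<gamma> ?W))"
        unfolding cramer3[of ?U ?V ?W g] \<alpha>_def \<beta>_def \<gamma>_def
        by (cases u; cases v; cases w) (simp add: algebra_simps del: mult_pCons_left mult_pCons_right)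
      finally show ?thesis .
    qed
    have "coeff (det3 g ?V ?W) 0 = det3 g0 v w" "coeff (det3 ?U g ?W) 0 = det3 u g0 w"
      by (cases u; cases v; cases w; simp add: det3_def g g0_def coeff_mult algebra_simps)+
    then have \<alpha>0: "coeff \<alpha> 0 \<noteq> 0" and \<beta>0: "coeff \<beta> 0 = 0"
      using D s by (simp_all add: \<alpha>_def \<beta>_def i_def coeff_mult det3_scale3)
    have \<gamma>0: "monom 1 a dvd \<gamma>" using dW by (simp add: \<gamma>_def dvd_smult)
    obtain \<alpha>' where \<alpha>': "monom 1 a dvd \<alpha> * \<alpha>' - 1" using poly_unit_mod_monom[OF \<alpha>0] by blast
    \<comment> \<open>Modulo \<open>t ^ a\<close> the arc is \<alpha> times \<open>u + s v\<close>
      with \<open>s\<close> = \<beta> / \<alpha>. As \<open>s\<close> has no constant term, this is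
      the straight arc, rescaled by \<alpha> and reparametrised with fixed base point.\<close>
    define h where "h = scale3 \<alpha> (pcompose3 (arc3 u v) (\<alpha>' * \<beta>))"
    obtain hx hy hz where hh: "h = (hx,hy,hz)" by (cases h)
    obtain ux uy uz vx vy vz wx wy wz where uvw: "u = (ux,uy,uz)" "v = (vx,vy,vz)" "w = (wx,wy,wz)"
      by (cases u; cases v; cases w)
    have key: "monom 1 a dvd (\<alpha> * [:x:] + (\<beta> * [:y:] + \<gamma> * [:z:])) - \<alpha> * pcompose [:x,y:] (\<alpha>' * \<beta>)"
      for x y z
    proof -
      have "(\<alpha> * [:x:] + (\<beta> * [:y:] + \<gamma> * [:z:])) - \<alpha> * pcompose [:x,y:] (\<alpha>' * \<beta>)
          = \<gamma> * [:z:] - (\<alpha> * \<alpha>' - 1) * (\<beta> * [:y:])"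
        by (simp add: pcompose_pCons algebra_simps del: mult_pCons_left mult_pCons_right)
      then show ?thesis using \<gamma>0 \<alpha>' by (metis dvd_diff dvd_mult2)
    qed
    have "monom 1 a dvd gx - hx" "monom 1 a dvd gy - hy" "monom 1 a dvd gz - hz"
      using g_dec hh key unfolding h_def g uvw by auto
    then have "monom 1 a dvd form_poly d c g - form_poly d c h"
      unfolding g hh by (rule form_poly_cong)
    moreover have "monom 1 a dvd form_poly d c h"
      unfolding h_def form_poly_scale3 form_poly_pcompose3
      using van \<beta>0 by (intro dvd_mult monom_dvd_pcompose) (auto simp: coeff_mult)
    ultimately show "monom 1 a dvd form_poly d c g" by (metis dvd_add diff_add_cancel)
  qed
qed

subsection \<open>Injectivity of evaluation\<close>

text \<open>The fibres of the affine curve over the \<open>x\<close>-line have \<open>q > d\<close> points each.\<close>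

lemma form_vanishing_imp_zero:
  fixes c :: "nat \<times> nat \<times> nat \<Rightarrow> 'a"
  assumes c: "c \<in> forms d" and d: "d < q" "card X0 + d < q ^ 2"
    and van: "\<And>x y. x \<notin> X0 \<Longrightarrow> y ^ q + y = x ^ (q + 1) \<Longrightarrow> form_eval d c (x,y,1) = 0"
  shows "c = (\<lambda>m. 0)"
proof -
  \<comment> \<open>\<open>r j\<close> collects the coefficient of \<open>y ^ j\<close> as a
    polynomial in \<open>x\<close>, and \<open>p x\<close> is the form on the fibre over
    \<open>x\<close>. Root counting is used twice: on each fibre, then on the complement of
    \<open>X0\<close>.\<close>
  define r where "r j = (\<Sum>i\<le>d - j. monom (c (i,j,d-i-j)) i)" for j
  define p where "p x = (\<Sum>j\<le>d. monom (poly (r j) x) j)" for x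
  have p: "poly (p x) y = form_eval d c (x,y,1)" for x y
  proof -
    have "form_eval d c (x,y,1) = (\<Sum>m\<in>mon_deg d. c m * x ^ fst m * y ^ fst (snd m))"
      by (simp add: form_eval_def case_prod_unfold)
    also have "\<dots> = (\<Sum>(j,i)\<in>(SIGMA j:{..d}. {..d-j}). c (i,j,d-i-j) * x ^ i * y ^ j)"
      by (rule sum.reindex_bij_witness[of _ "\<lambda>(j,i). (i,j,d-i-j)" "\<lambda>(i,j,k). (j,i)"])
        (auto simp: mon_deg_def)
    also have "\<dots> = (\<Sum>j\<le>d. \<Sum>i\<le>d-j. c (i,j,d-i-j) * x ^ i * y ^ j)"
      by (rule sum.Sigma[symmetric]) auto
    also have "\<dots> = poly (p x) y"
      by (simp add: p_def r_def poly_sum poly_monom sum_distrib_right)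
    finally show ?thesis by simp
  qed
  have r0: "poly (r j) x = 0" if x: "x \<notin> X0" and j: "j \<le> d" for x j
  proof -
    have "degree (p x) \<le> d" unfolding p_def
      by (intro degree_sum_le) (auto intro: order_trans[OF degree_monom_le])
    then have "p x = 0"
      using card_trace_fibre[OF norm_frob, of x] d van[OF x] p
      by (intro poly_eqI_degree[of "{y. y ^ q + y = x ^ (q + 1)}"]) auto
    then have "coeff (p x) j = 0" by simp
    then show ?thesis using j by (simp add: p_def coeff_sum)
  qed
  have rj: "r j = 0" if j: "j \<le> d" for j
  proof -
    have "degree (r j) \<le> d" unfolding r_def
      by (intro degree_sum_le) (auto intro: order_trans[OF degree_monom_le])
    moreover have "card (- X0) = q ^ 2 - card X0"
      using card_field by (simp add: Compl_eq_Diff_UNIV card_Diff_subset)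
    ultimately show ?thesis
      using d r0[OF _ j] by (intro poly_eqI_degree[of "- X0"]) auto
  qed
  show ?thesis
  proof
    fix m :: "nat \<times> nat \<times> nat"
    obtain i j k where m: "m = (i,j,k)" by (cases m)
    show "c m = 0"
    proof (cases "m \<in> mon_deg d")
      case True
      then have k: "k = d - i - j" "i \<le> d - j" "j \<le> d" by (auto simp: m mon_deg_def)
      have "coeff (r j) i = c (i,j,d-i-j)" using k by (simp add: r_def coeff_sum)
      then show ?thesis using rj[OF k(3)] k by (simp add: m)
    qed (use c in \<open>unfold forms_def, blast\<close>)
  qed
qed

end

subsection \<open>Counting points of a subspace\<close>

text \<open>Coordinates in a basis identify \<open>V\<close> with the functions from the basis to
  the field; this is how a dimension is read off from a cardinality.\<close>

lemma card_subspace_eq_power_dim: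
  fixes scale :: "'a::{finite,field} \<Rightarrow> 'b::ab_group_add \<Rightarrow> 'b"
  assumes vs: "vector_space scale" and sub: "module.subspace scale V" and fin: "finite V"
  shows "card V = card (UNIV :: 'a set) ^ vector_space.dim scale V"
proof -
  interpret vector_space scale by fact
  obtain B where B: "B \<subseteq> V" "independent B" "V \<subseteq> span B" "card B = dim V"
    using basis_exists by blast
  have fB: "finite B" using B fin finite_subset by blast
  have sp: "span B = V" using B sub span_minimal by blast
  define f where "f g = (\<Sum>b\<in>B. scale (g b) b)" for g
  have "inj_on f (B \<rightarrow>\<^sub>E UNIV)"
  proof (rule inj_onI)
    fix g h assume gh: "g \<in> B \<rightarrow>\<^sub>E UNIV" "h \<in> B \<rightarrow>\<^sub>E UNIV" "f g = f h"
    then have "(\<Sum>b\<in>B. scale (g b - h b) b) = 0"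
      by (simp add: f_def scale_left_diff_distrib sum_subtractf)
    then have "dependent B" if "b \<in> B" "g b - h b \<noteq> 0" for b
      unfolding dependent_finite[OF fB] using that by (intro exI[of _ "\<lambda>b. g b - h b"]) blast
    then have "g b = h b" if "b \<in> B" for b using that B(2) right_minus_eq by blast
    then show "g = h" by (rule PiE_ext[OF gh(1,2)])
  qed
  moreover have "f ` (B \<rightarrow>\<^sub>E UNIV) = V"
  proof -
    have "f ` (B \<rightarrow>\<^sub>E UNIV) = range f"
    proof (intro equalityI subsetI)
      fix x assume "x \<in> range f"
      then obtain g where "x = f g" by blast
      then have "x = f (restrict g B)" by (simp add: f_def)
      then show "x \<in> f ` (B \<rightarrow>\<^sub>E UNIV)" by auto
    qed auto
    then show ?thesis using span_finite[OF fB] sp by (simp add: f_def)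
  qed
  ultimately have "card V = card (B \<rightarrow>\<^sub>E (UNIV :: 'a set))" by (metis card_image)
  then show ?thesis using B fB by (simp add: card_funcsetE)
qed

lemma vector_space_fun: "vector_space (\<lambda>s (f::'b \<Rightarrow> 'a::field) x. s * f x)"
  by unfold_locales (auto simp: fun_eq_iff algebra_simps)

subsection \<open>Separating points by forms\<close>

lemma cover_by_lines:
  fixes f :: "'b \<Rightarrow> 'a::field vec3"
  assumes "finite R" "\<And>x. x \<in> R \<Longrightarrow> cross3 (f x) z \<noteq> (0,0,0)"
  shows "\<exists>ls. length ls = card R \<and> (\<forall>l\<in>set ls. dot3 l z \<noteq> 0) \<and> (\<forall>x\<in>R. \<exists>l\<in>set ls. dot3 l (f x) = 0)"
  using assms
proof (induction R rule: finite_induct)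
  case (insert x R)
  then obtain ls where ls: "length ls = card R" "\<forall>l\<in>set ls. dot3 l z \<noteq> 0"
    "\<forall>x\<in>R. \<exists>l\<in>set ls. dot3 l (f x) = 0" by auto
  obtain l where l: "dot3 l (f x) = 0" "dot3 l z \<noteq> 0"
    using separating_line[of "f x" z] insert.prems by auto
  show ?case by (intro exI[of _ "l # ls"]) (use ls l insert in auto)
qed auto

text \<open>\<open>u i\<close> represents the \<open>i\<close>-th point, \<open>v i\<close> spans
  its tangent together with \<open>u i\<close>, and \<open>w i\<close> is a point off that tangent.
  The bound on the sum is written additively to avoid truncated subtraction.\<close>

locale herm_triangle = hermitian_field q ty
  for q :: nat and ty :: "'a::{finite,field} itself" +
  fixes u v w :: "nat \<Rightarrow> 'a vec3" and a :: "nat \<Rightarrow> nat" and d :: nat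
  assumes iso: "i \<in> {1,2,3} \<Longrightarrow> dot3 (tang q (u i)) (u i) = 0"
    and tan: "i \<in> {1,2,3} \<Longrightarrow> dot3 (tang q (u i)) (v i) = 0"
    and trans: "i \<in> {1,2,3} \<Longrightarrow> dot3 (tang q (u i)) (w i) \<noteq> 0"
    and basis: "i \<in> {1,2,3} \<Longrightarrow> det3 (u i) (v i) (w i) \<noteq> 0"
    and sep: "i \<in> {1,2,3} \<Longrightarrow> j \<in> {1,2,3} \<Longrightarrow> i \<noteq> j \<Longrightarrow> dot3 (tang q (u i)) (u j) \<noteq> 0"
    and indep: "det3 (u 1) (u 2) (u 3) \<noteq> 0"
    and d_bounds: "5 \<le> d" "d < q"
    and a_bounds: "i \<in> {1,2,3} \<Longrightarrow> 1 \<le> a i \<and> a i \<le> d"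
    and a_sum: "a 1 + a 2 + a 3 + 5 \<le> 3 * d"
    and a_max: "i \<in> {1,2,3} \<Longrightarrow> j \<in> {1,2,3} \<Longrightarrow> i \<noteq> j \<Longrightarrow> a i = d \<Longrightarrow> a j \<noteq> d"
begin

abbreviation arc :: "nat \<Rightarrow> 'a poly vec3" where
  "arc i \<equiv> arc3 (u i) (v i)"

text \<open>By \<open>vanishes_on_iff\<close> these are the forms vanishing on the scheme
  \<open>E\<close>, tested on one straight arc per point.\<close>

definition E_forms :: "(nat \<times> nat \<times> nat \<Rightarrow> 'a) set" where
  "E_forms = {c \<in> forms d. \<forall>i\<in>{1,2,3}. monom 1 (a i) dvd form_poly d c (arc i)}"

lemma interpolation_perm:
  assumes "i \<in> {1,2,3}" "j \<in> {1,2,3}" "k \<in> {1,2,3}" "i \<noteq> j" "j \<noteq> k" "i \<noteq> k"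
    and "2 \<le> e" "a i \<le> e + 1" "a j \<le> e" "a k \<le> e - 1"
  shows "\<exists>F. is_form e F \<and> (\<forall>i\<in>{1,2,3}. monom 1 (a i) dvd F (arc i) - r i)"
proof -
  obtain F where "is_form e F" "monom 1 (a i) dvd F (arc i) - r i"
    "monom 1 (a j) dvd F (arc j) - r j" "monom 1 (a k) dvd F (arc k) - r k"
    using three_arc_interpolation[OF basis[OF assms(1)] basis[OF assms(2)] basis[OF assms(3)]
        iso[OF assms(1)] tan[OF assms(1)] sep[OF assms(1,2,4)] sep[OF assms(1,3,6)]
        iso[OF assms(2)] tan[OF assms(2)] sep[OF assms(2,3,5)] assms(7-10), of "r i" "r j" "r k"]
    by blast
  moreover have "{1,2,3} = {i,j,k}" using assms(1-6) by auto
  ultimately show ?thesis by auto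
qed

lemma interpolation:
  assumes "e = d \<or> e = d - 1"
  shows "\<exists>F. is_form e F \<and> (\<forall>i\<in>{1,2,3}. monom 1 (a i) dvd F (arc i) - r i)"
proof -
  have e: "2 \<le> e" using assms d_bounds by auto
  \<comment> \<open>The last point in the peeling must have multiplicity at most
    \<open>d - 2\<close>; a point of multiplicity \<open>d\<close>, if there is one among the
    others, goes first.\<close>
  have step: ?thesis
    if ijk: "i \<in> {1,2,3}" "j \<in> {1,2,3}" "k \<in> {1,2,3}" "i \<noteq> j" "j \<noteq> k" "i \<noteq> k" and k: "a k \<le> d - 2" for i j k
  proof (cases "a i = d")
    case True
    then have "a j \<noteq> d" using a_max[OF ijk(1,2,4)] by simp
    then have "a i \<le> e + 1" "a j \<le> e" "a k \<le> e - 1"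
      using True k assms d_bounds a_bounds[OF ijk(2)] by linarith+
    then show ?thesis using interpolation_perm[OF ijk e] by blast
  next
    case False
    then have *: "a j \<le> e + 1" "a i \<le> e" "a k \<le> e - 1"
      using k assms d_bounds a_bounds[OF ijk(1)] a_bounds[OF ijk(2)] by linarith+
    show ?thesis
      by (rule interpolation_perm[OF ijk(2,1,3) ijk(4)[symmetric] ijk(6,5) e *])
  qed
  have "a 1 \<le> d - 2 \<or> a 2 \<le> d - 2 \<or> a 3 \<le> d - 2" using a_sum by linarith
  then show ?thesis using step[of 2 3 1] step[of 1 3 2] step[of 1 2 3] by auto
qed

lemma linear_arc_zero: "i \<in> {1,2,3} \<Longrightarrow> dot3 (const3 (tang q (u i))) (arc i) = 0"
  by (simp only: dot3_const3_arc3 iso tan) simp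

lemma prod_const3_eq_0_iff:
  "(\<Prod>l\<leftarrow>ls. dot3 (const3 l) (const3 x)) = 0 \<longleftrightarrow> (\<exists>l\<in>set ls. dot3 l (x::'a vec3) = 0)"
proof (induction ls)
  case (Cons l ls)
  have "dot3 (const3 l) (const3 x) = 0 \<longleftrightarrow> dot3 l x = 0" by (simp add: dot3_const3_const3)
  then show ?case using Cons by simp
qed simp

end

text \<open>A dual codeword stripped to its support \<open>S\<close> and its nonzero values
  \<open>wt\<close>: a linear relation between the evaluations at \<open>S\<close> of all forms
  vanishing on \<open>E\<close>.\<close>

locale herm_relation = herm_triangle q ty u v w a d
  for q :: nat and ty :: "'a::{finite,field} itself" and u v w a d +
  fixes S :: "'b set" and rep :: "'b \<Rightarrow> 'a vec3" and wt :: "'b \<Rightarrow> 'a"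
  assumes fin: "finite S" and ne: "S \<noteq> {}" and card_S: "card S \<le> d"
    and wt: "x \<in> S \<Longrightarrow> wt x \<noteq> 0"
    and off: "x \<in> S \<Longrightarrow> i \<in> {1,2,3} \<Longrightarrow> dot3 (tang q (u i)) (rep x) \<noteq> 0"
    and dist: "x \<in> S \<Longrightarrow> y \<in> S \<Longrightarrow> x \<noteq> y \<Longrightarrow> cross3 (rep x) (rep y) \<noteq> (0,0,0)"
    and rel: "c \<in> E_forms \<Longrightarrow> (\<Sum>x\<in>S. wt x * form_eval d c (rep x)) = 0"
begin

text \<open>In the relation for \<open>F\<close> only the term at \<open>x\<close> is left, and its
  weight is nonzero.\<close>

lemma no_separating_form:
  assumes F: "is_form d F" and van: "\<And>i. i \<in> {1,2,3} \<Longrightarrow> monom 1 (a i) dvd F (arc i)"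
    and x: "x \<in> S" "\<And>y. y \<in> S \<Longrightarrow> y \<noteq> x \<Longrightarrow> F (const3 (rep y)) = 0"
  shows "F (const3 (rep x)) = 0"
proof -
  obtain c where c: "c \<in> forms d" "\<And>g. F g = form_poly d c g" using F by (auto simp: is_form_def)
  have "c \<in> E_forms" using c van by (auto simp: E_forms_def)
  then have "0 = (\<Sum>y\<in>S. wt y * form_eval d c (rep y))" using rel by simp
  also have "\<dots> = (\<Sum>y\<in>{x}. wt y * form_eval d c (rep y))"
    by (rule sum.mono_neutral_right) (use fin x in \<open>auto simp: c form_poly_const3\<close>)
  finally show ?thesis using wt[OF x(1)] by (simp add: c form_poly_const3)
qed

lemma rep_nonzero: "x \<in> S \<Longrightarrow> rep x \<noteq> (0,0,0)"
  using off[of x 1] by (metis dot3_commute dot3_zero_left insertI1)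

lemma no_short_cover:
  assumes x: "x \<in> S" and ls: "length ls + 3 \<le> d" "\<forall>l\<in>set ls. dot3 l (rep x) \<noteq> 0"
    and cover: "\<And>y. y \<in> S \<Longrightarrow> y \<noteq> x \<Longrightarrow> \<exists>l\<in>set ls. dot3 l (rep y) = 0"
  shows False
proof -
  obtain l0 where l0: "dot3 l0 (rep x) \<noteq> 0" using nonvanishing_line rep_nonzero[OF x] by blast
  \<comment> \<open>The three tangents make the product zero along all three arcs, and copies of
    \<open>l0\<close> pad the degree to exactly \<open>d\<close> without vanishing at
    \<open>x\<close>.\<close>
  define ls' where "ls' = map (\<lambda>i. tang q (u i)) [1,2,3] @ ls @ replicate (d - 3 - length ls) l0"
  define F where "F g = (\<Prod>l\<leftarrow>ls'. dot3 (const3 l) g)" for g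
  have "length ls' = d" using ls by (simp add: ls'_def)
  then have "is_form d F" unfolding F_def using is_form_prod_linear[of ls'] by simp
  moreover have "F (arc i) = 0" if "i \<in> {1,2,3}" for i
    using that linear_arc_zero[OF that] unfolding F_def ls'_def prod_list_zero_iff by force
  then have "monom 1 (a i) dvd F (arc i)" if "i \<in> {1,2,3}" for i using that by simp
  moreover have "F (const3 (rep y)) = 0" if "y \<in> S" "y \<noteq> x" for y
    using cover[OF that] unfolding F_def prod_const3_eq_0_iff ls'_def set_append by blast
  ultimately have "F (const3 (rep x)) = 0" using no_separating_form x by blast
  moreover have "dot3 l (rep x) \<noteq> 0" if "l \<in> set ls'" for l
    using that ls l0 off[OF x] by (auto simp: ls'_def)
  then have "F (const3 (rep x)) \<noteq> 0" unfolding F_def prod_const3_eq_0_iff by blast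
  ultimately show False by simp
qed

text \<open>The budget is \<open>d - 3\<close> lines. Points of \<open>R\<close> cost one line each;
  the lines of \<open>ls0\<close> are meant to pass through several points of \<open>S\<close> at
  once.\<close>

lemma cover_with_pairs:
  assumes x: "x \<in> S" and R: "R \<subseteq> S - {x}"
    and ps: "length ls0 + card R + 3 \<le> d" "\<forall>l\<in>set ls0. dot3 l (rep x) \<noteq> 0"
    and cover: "\<And>y. y \<in> S \<Longrightarrow> y \<noteq> x \<Longrightarrow> y \<notin> R \<Longrightarrow> \<exists>l\<in>set ls0. dot3 l (rep y) = 0"
  shows False
proof -
  have "finite R" using R fin finite_subset by blast
  moreover have "cross3 (rep y) (rep x) \<noteq> (0,0,0)" if "y \<in> R" for y
    using dist[of y x] x R that by auto
  ultimately obtain ls where ls: "length ls = card R" "\<forall>l\<in>set ls. dot3 l (rep x) \<noteq> 0"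
    "\<forall>y\<in>R. \<exists>l\<in>set ls. dot3 l (rep y) = 0"
    using cover_by_lines[of R rep "rep x"] by blast
  show False
  proof (rule no_short_cover[OF x, of "ls0 @ ls"])
    fix y assume "y \<in> S" "y \<noteq> x"
    then show "\<exists>l\<in>set (ls0 @ ls). dot3 l (rep y) = 0" using ls(3) cover by (cases "y \<in> R") auto
  qed (use ls ps in auto)
qed

text \<open>With at most \<open>d - 2\<close> points in \<open>S\<close>, one line for each point
  other than \<open>x\<close> would already stay within the budget.\<close>

lemma card_S_ge: "d \<le> card S + 1"
proof (rule ccontr)
  assume "\<not> ?thesis"
  moreover obtain x where x: "x \<in> S" using ne by blast
  moreover have "card (S - {x}) = card S - 1" using x fin by simp
  moreover have "card S > 0" using fin ne by (simp add: card_gt_0_iff)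
  ultimately show False using cover_with_pairs[OF x, of "S - {x}" "[]"] by auto
qed

text \<open>If \<open>S\<close> spans the plane, two disjoint pairs of points, each not aligned with a suitable
  \<open>x\<close>, save the two lines needed to cover \<open>S - {x}\<close> by \<open>d - 3\<close> lines missing \<open>x\<close>.\<close>

lemma S_collinear: "\<exists>n. n \<noteq> (0,0,0) \<and> (\<forall>x\<in>S. dot3 n (rep x) = 0)"
proof (rule ccontr)
  assume nc: "\<not> ?thesis"
  obtain x where x: "x \<in> S" using ne by blast
  have "card S \<ge> 4" using card_S_ge d_bounds by linarith
  then have "card (S - {x}) \<noteq> 0" using x fin by simp
  then have "S - {x} \<noteq> {}" by (metis card.empty)
  then obtain y where y: "y \<in> S" "y \<noteq> x" by blast
  have "cross3 (rep x) (rep y) \<noteq> (0,0,0)" using dist x y by auto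
  then obtain z where z: "z \<in> S" "dot3 (cross3 (rep x) (rep y)) (rep z) \<noteq> 0" using nc by blast
  have zxy: "z \<noteq> x" "z \<noteq> y" using z by auto
  have pair: "dot3 (cross3 (rep s) (rep t)) (rep x) \<noteq> 0" if "dot3 (cross3 (rep x) (rep s)) (rep t) \<noteq> 0" for s t
    using that by (metis det3_eq_dot3_cross3 det3_rotate)
  define T where "T = S - {x,y,z}"
  have cT: "card T + 3 = card S"
    using x y z zxy fin \<open>card S \<ge> 4\<close> unfolding T_def by (subst card_Diff_subset) auto
  show False
  proof (cases "card S = d")
    case False
    then have cS: "card S + 1 = d" using card_S_ge card_S by linarith
    \<comment> \<open>Here saving a single line is enough: \<open>y\<close> and \<open>z\<close>
      share one, and the \<open>d - 4\<close> points of \<open>T\<close> cost one each.\<close>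
    show False
      by (rule cover_with_pairs[OF x, of T "[cross3 (rep y) (rep z)]"])
        (use cT cS pair[OF z(2)] in \<open>auto simp: T_def\<close>)
  next
    case True
    \<comment> \<open>If a line contains all of \<open>S\<close> but one point \<open>t\<close>, it
      covers \<open>S - {t}\<close> by itself.\<close>
    have one_off: False if "n \<noteq> (0,0,0)" "t \<in> S" "\<And>s. s \<in> S \<Longrightarrow> s \<noteq> t \<Longrightarrow> dot3 n (rep s) = 0" for n t
    proof (rule no_short_cover[OF that(2), of "[n]"])
      have "dot3 n (rep t) \<noteq> 0" using nc that by metis
      then show "\<forall>l\<in>set [n]. dot3 l (rep t) \<noteq> 0" by simp
    qed (use that d_bounds in auto)
    \<comment> \<open>Two lines through two points each and one for each of the remaining
      \<open>d - 5\<close> points make \<open>d - 3\<close> lines.\<close>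
    have two: False if "s1 \<in> S" "t1 \<in> S" "s2 \<in> S" "t2 \<in> S" "x \<notin> {s1,t1,s2,t2}" "card {s1,t1,s2,t2} = 4"
      "dot3 (cross3 (rep x) (rep s1)) (rep t1) \<noteq> 0" "dot3 (cross3 (rep x) (rep s2)) (rep t2) \<noteq> 0"
      for s1 t1 s2 t2
    proof (rule cover_with_pairs[OF x, of "S - {x,s1,t1,s2,t2}" "[cross3 (rep s1) (rep t1), cross3 (rep s2) (rep t2)]"])
      have "card {x,s1,t1,s2,t2} = 5" using that by (subst card_insert_disjoint) auto
      then have "card (S - {x,s1,t1,s2,t2}) = d - 5"
        using True that x by (subst card_Diff_subset) auto
      then show "length [cross3 (rep s1) (rep t1), cross3 (rep s2) (rep t2)] + card (S - {x,s1,t1,s2,t2}) + 3 \<le> d"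
        using d_bounds by simp
    qed (use pair that in auto)
    have "card T \<ge> 2" using cT True d_bounds by linarith
    then obtain s t where st: "s \<in> T" "t \<in> T" "s \<noteq> t"
      by (metis card_le_Suc0_iff_eq card.infinite not_less_eq_eq numeral_2_eq_2 zero_le)
    have stS: "s \<in> S" "t \<in> S" "s \<notin> {x,y,z}" "t \<notin> {x,y,z}" using st by (auto simp: T_def)
    let ?n = "cross3 (rep x) (rep s)"
    have n0: "?n \<noteq> (0,0,0)" "cross3 (rep x) (rep t) \<noteq> (0,0,0)" using dist x stS by auto
    \<comment> \<open>Otherwise \<open>{y,z}\<close> and \<open>{s,r}\<close> are two pairs whose
      lines miss \<open>x\<close>.\<close>
    have Tn: "dot3 ?n (rep r) = 0" if "r \<in> T" for r
    proof (rule ccontr)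
      assume r: "dot3 ?n (rep r) \<noteq> 0"
      then have "r \<noteq> s" by auto
      have "r \<in> S" "r \<notin> {x,y,z}" using that by (auto simp: T_def)
      then have "card {y,z,s,r} = 4" using stS \<open>r \<noteq> s\<close> zxy by auto
      then show False using two[of y z s r] stS \<open>r \<in> S\<close> \<open>r \<notin> {x,y,z}\<close> y z zxy r by auto
    qed
    have yn: "dot3 ?n (rep y) \<noteq> 0"
    proof
      assume "dot3 ?n (rep y) = 0"
      then have "dot3 ?n (rep r) = 0" if "r \<in> S" "r \<noteq> z" for r
        using that Tn[of r] by (cases "r \<in> {x,y}") (auto simp: T_def)
      then show False by (rule one_off[OF n0(1) z(1)])
    qed
    have zn: "dot3 ?n (rep z) \<noteq> 0"
    proof
      assume "dot3 ?n (rep z) = 0"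
      then have "dot3 ?n (rep r) = 0" if "r \<in> S" "r \<noteq> y" for r
        using that Tn[of r] by (cases "r \<in> {x,z}") (auto simp: T_def)
      then show False by (rule one_off[OF n0(1) y(1)])
    qed
    \<comment> \<open>The lines from \<open>x\<close> to \<open>s\<close> and to \<open>t\<close>
      coincide, so \<open>z\<close> is off the latter as well, and \<open>{s,y}\<close> and
      \<open>{t,z}\<close> are the two pairs.\<close>
    obtain k where "k \<noteq> 0" "?n = scale3 k (cross3 (rep x) (rep t))"
      using common_normal_unique[OF n0(2) n0(2) n0(1)] Tn[OF st(2)] by auto
    then have "dot3 (cross3 (rep x) (rep t)) (rep z) \<noteq> 0" using zn by (auto simp: dot3_scale3_left)
    moreover have "card {s,y,t,z} = 4" using stS st(3) zxy y by auto
    ultimately show False using two[of s y t z] yn stS y z zxy by auto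
  qed
qed

text \<open>If \<open>S\<close> lies on the line \<open>n\<close>, then a product \<open>f\<close> of \<open>d\<close> lines separating \<open>x\<close> from the rest of
  \<open>S\<close> and from the \<open>u i\<close> on \<open>n\<close> can be corrected by a multiple of \<open>n\<close> to vanish on \<open>E\<close>.\<close>

lemma S_on_side:
  "card S = d \<and> (\<exists>i\<in>{1,2,3}. \<exists>j\<in>{1,2,3}. i \<noteq> j \<and> (\<forall>x\<in>S. det3 (u i) (u j) (rep x) = 0))"
proof -
  obtain n where n: "n \<noteq> (0,0,0)" "\<And>x. x \<in> S \<Longrightarrow> dot3 n (rep x) = 0" using S_collinear by blast
  obtain x where x: "x \<in> S" using ne by blast
  define J where "J = {i\<in>{1,2,3}. dot3 n (u i) = 0}"
  have fJ: "finite J" by (simp add: J_def)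
  have "card J \<le> 2"
  proof (rule ccontr)
    assume "\<not> card J \<le> 2"
    then have "J = {1,2,3}" by (intro card_seteq) (auto simp: J_def)
    then have "dot3 n (u 1) = 0" "dot3 n (u 2) = 0" "dot3 n (u 3) = 0"
      unfolding J_def by (metis (mono_tags, lifting) insertCI mem_Collect_eq)+
    then show False using det3_eq_0_if_common_normal[OF n(1)] indep by blast
  qed
  have "card S - 1 + card J > d"
  proof (rule ccontr)
    assume "\<not> ?thesis"
    then have le: "card S - 1 + card J \<le> d" by simp
    obtain l0 where l0: "dot3 l0 (rep x) \<noteq> 0" using nonvanishing_line rep_nonzero[OF x] by blast
    have "cross3 (rep y) (rep x) \<noteq> (0,0,0)" if "y \<in> S - {x}" for y
      using dist[of y x] x that by auto
    then obtain ls1 where ls1: "length ls1 = card (S - {x})" "\<forall>l\<in>set ls1. dot3 l (rep x) \<noteq> 0"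
      "\<forall>y\<in>S - {x}. \<exists>l\<in>set ls1. dot3 l (rep y) = 0"
      using cover_by_lines[of "S - {x}" rep "rep x"] fin by blast
    have "cross3 (u i) (rep x) \<noteq> (0,0,0)" if "i \<in> J" for i
    proof
      assume eq: "cross3 (u i) (rep x) = (0,0,0)"
      have i: "i \<in> {1,2,3}" using that by (simp add: J_def)
      have "u i \<noteq> (0,0,0)" using basis[OF i] by (metis det3_eq_dot3_cross3 det3_rotate dot3_commute dot3_zero_left)
      then obtain k where "rep x = scale3 k (u i)" using cross3_eq_0_parallel[OF eq _ rep_nonzero[OF x]] by blast
      then show False using off[OF x i] iso[OF i] by (simp add: dot3_scale3)
    qed
    then obtain ls2 where ls2: "length ls2 = card J" "\<forall>l\<in>set ls2. dot3 l (rep x) \<noteq> 0"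
      "\<forall>i\<in>J. \<exists>l\<in>set ls2. dot3 l (u i) = 0"
      using cover_by_lines[OF fJ, of u "rep x"] by blast
    define ls where "ls = ls1 @ ls2 @ replicate (d - length ls1 - length ls2) l0"
    define f where "f g = (\<Prod>l\<leftarrow>ls. dot3 (const3 l) g)" for g
    have "length ls = d" using le x fin by (simp add: ls_def ls1(1) ls2(1))
    then have ff: "is_form d f" unfolding f_def using is_form_prod_linear[of ls] by simp
    let ?N = "dot3 (const3 n)"
    \<comment> \<open>Locally at each \<open>u i\<close>, \<open>f\<close> is a multiple of
      \<open>n\<close> modulo \<open>t ^ a i\<close>. Off the line \<open>n\<close> is a unit; on
      it, \<open>n\<close> restricts to a nonzero multiple of \<open>t\<close> and \<open>f\<close>
      has a zero through a line of \<open>ls2\<close>.\<close>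
    have "\<exists>r. monom 1 (a i) dvd f (arc i) - ?N (arc i) * r" if i: "i \<in> {1,2,3}" for i
    proof (cases "i \<in> J")
      case False
      then have "dot3 n (u i) \<noteq> 0" using i unfolding J_def by blast
      then have "coeff (?N (arc i)) 0 \<noteq> 0" by (simp add: dot3_const3_arc3)
      then obtain p where "monom 1 (a i) dvd ?N (arc i) * p - 1" using poly_unit_mod_monom by blast
      then have "monom 1 (a i) dvd - ((?N (arc i) * p - 1) * f (arc i))" by (simp only: dvd_minus_iff dvd_mult2)
      moreover have "- ((?N (arc i) * p - 1) * f (arc i)) = f (arc i) - ?N (arc i) * (p * f (arc i))"
        by (simp add: algebra_simps)
      ultimately show ?thesis by metis
    next
      case True
      then have nu: "dot3 n (u i) = 0" by (simp add: J_def)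
      define \<kappa> where "\<kappa> = dot3 n (v i)"
      \<comment> \<open>Otherwise \<open>n\<close> would be the tangent at \<open>u i\<close>, which
        contains no point of \<open>S\<close>.\<close>
      have "\<kappa> \<noteq> 0"
      proof
        assume "\<kappa> = 0"
        moreover have "cross3 (u i) (v i) \<noteq> (0,0,0)" using basis[OF i] by (auto simp: det3_eq_dot3_cross3)
        moreover have "tang q (u i) \<noteq> (0,0,0)" using off[OF x i] by auto
        ultimately obtain k where "tang q (u i) = scale3 k n"
          using common_normal_unique[of "u i" "v i" n "tang q (u i)"] n(1) nu iso[OF i] tan[OF i]
          by (auto simp: \<kappa>_def)
        then show False using off[OF x i] n(2)[OF x] by (simp add: dot3_scale3_left)
      qed
      obtain l where l: "l \<in> set ls" "dot3 l (u i) = 0" using ls2(3) True unfolding ls_def set_append by blast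
      then have "coeff (dot3 (const3 l) (arc i)) 0 = 0" by (simp add: dot3_const3_arc3)
      then have "monom 1 1 dvd dot3 (const3 l) (arc i)" by (simp add: monom_1_dvd_iff')
      moreover have "dot3 (const3 l) (arc i) dvd f (arc i)"
        unfolding f_def using l(1) by (intro prod_list_dvd) auto
      ultimately obtain p where p: "f (arc i) = monom 1 1 * p" by (meson dvd_trans dvdE)
      have "?N (arc i) = [:0, \<kappa>:]" by (simp add: dot3_const3_arc3 nu \<kappa>_def)
      also have "\<dots> = monom 1 1 * [:\<kappa>:]" by (simp add: monom_Suc)
      finally have "?N (arc i) * ([:inverse \<kappa>:] * p) = monom 1 1 * ([:\<kappa>:] * [:inverse \<kappa>:]) * p"
        by (simp only: mult_ac)
      also have "\<dots> = f (arc i)" using \<open>\<kappa> \<noteq> 0\<close> p by (simp add: one_pCons[symmetric])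
      finally show ?thesis by (metis diff_self dvd_0_right)
    qed
    then obtain r where r: "\<And>i. i \<in> {1,2,3} \<Longrightarrow> monom 1 (a i) dvd f (arc i) - ?N (arc i) * r i" by metis
    obtain h where h: "is_form (d - 1) h" "\<And>i. i \<in> {1,2,3} \<Longrightarrow> monom 1 (a i) dvd h (arc i) - r i"
      using interpolation[of "d - 1" r] by auto
    \<comment> \<open>The correction is a multiple of \<open>n\<close>, hence invisible on
      \<open>S\<close>; its cofactor \<open>h\<close> has degree \<open>d - 1\<close>.\<close>
    define F where "F g = f g + - (?N g * h g)" for g
    have "is_form (Suc (d - 1)) (\<lambda>g. ?N g * h g)" by (rule is_form_mult_linear[OF h(1)])
    then have "is_form d F" unfolding F_def
      using ff d_bounds by (intro is_form_add is_form_minus) auto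
    moreover have "monom 1 (a i) dvd F (arc i)" if i: "i \<in> {1,2,3}" for i
    proof -
      have "F (arc i) = (f (arc i) - ?N (arc i) * r i) - ?N (arc i) * (h (arc i) - r i)"
        by (simp add: F_def algebra_simps)
      then show ?thesis using r[OF i] h(2)[OF i] by (metis dvd_diff dvd_mult)
    qed
    moreover have FS: "F (const3 (rep y)) = f (const3 (rep y))" if "y \<in> S" for y
      using n(2)[OF that] by (simp add: F_def dot3_const3_const3)
    moreover have "f (const3 (rep y)) = 0" if y: "y \<in> S" "y \<noteq> x" for y
    proof -
      obtain l where "l \<in> set ls" "dot3 l (rep y) = 0" using ls1(3) y unfolding ls_def set_append by blast
      then show ?thesis unfolding f_def prod_const3_eq_0_iff by blast
    qed
    ultimately have "f (const3 (rep x)) = 0" using no_separating_form[of F x] x by simp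
    moreover have "dot3 l (rep x) \<noteq> 0" if "l \<in> set ls" for l
      using that ls1 ls2 l0 by (auto simp: ls_def)
    then have "f (const3 (rep x)) \<noteq> 0" unfolding f_def prod_const3_eq_0_iff by blast
    ultimately show False by simp
  qed
  \<comment> \<open>The bounds \<open>card S \<le> d\<close> and \<open>card J \<le> 2\<close> leave
    no slack in the inequality.\<close>
  then have "card S = d" "card J = 2" using \<open>card J \<le> 2\<close> card_S d_bounds by linarith+
  moreover from this obtain i j where "J = {i,j}" "i \<noteq> j" by (meson card_2_iff)
  then have "i \<in> {1,2,3}" "j \<in> {1,2,3}" "dot3 n (u i) = 0" "dot3 n (u j) = 0" "i \<noteq> j"
    unfolding J_def by blast+
  ultimately show ?thesis
    using det3_eq_0_if_common_normal[OF n(1)] n(2) by blast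
qed

end

subsection \<open>Dimension and minimum distance of the code\<close>

lemma card_fun_support:
  fixes K :: "'b set"
  assumes "finite K"
  shows "finite {f :: 'b \<Rightarrow> 'a::{finite,zero}. \<forall>x. x \<notin> K \<longrightarrow> f x = 0}"
    and "card {f :: 'b \<Rightarrow> 'a::{finite,zero}. \<forall>x. x \<notin> K \<longrightarrow> f x = 0} = card (UNIV :: 'a set) ^ card K"
proof -
  let ?A = "{f :: 'b \<Rightarrow> 'a. \<forall>x. x \<notin> K \<longrightarrow> f x = 0}"
  have bij: "bij_betw (\<lambda>f. restrict f K) ?A (K \<rightarrow>\<^sub>E (UNIV :: 'a set))"
    by (rule bij_betw_byWitness[where f' = "\<lambda>f x. if x \<in> K then f x else 0"])
      (auto simp: fun_eq_iff PiE_def extensional_def)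
  show "card ?A = card (UNIV :: 'a set) ^ card K"
    using bij_betw_same_card[OF bij] assms by (simp add: card_funcsetE)
  show "finite ?A" using bij_betw_finite[OF bij] assms by (simp add: finite_PiE)
qed

lemma forms_eq: "forms d = {f. \<forall>x. x \<notin> mon_deg d \<longrightarrow> f x = 0}"
  unfolding forms_def by blast

lemma form_eval_add: "form_eval d (\<lambda>m. c m + c' m) x = form_eval d c x + form_eval d c' (x::'a::comm_ring_1 vec3)"
  using form_poly_add[of d c c' "const3 x"] by (simp add: form_poly_const3)

lemma form_eval_smult: "form_eval d (\<lambda>m. s * c m) x = s * form_eval d c (x::'a::comm_ring_1 vec3)"
  using form_poly_smult[of d s c "const3 x"] by (simp add: form_poly_const3)

section \<open>The codimension of the space of forms vanishing on \<open>E\<close>\<close>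

context herm_triangle
begin

lemma card_field_gt_1: "1 < card (UNIV :: 'a set)"
  unfolding card_field using q_ge_2 by (intro one_less_power) auto

lemma E_forms_add: "c \<in> E_forms \<Longrightarrow> c' \<in> E_forms \<Longrightarrow> (\<lambda>m. c m + c' m) \<in> E_forms"
  by (auto simp: E_forms_def forms_eq form_poly_add)

lemma E_forms_smult: "c \<in> E_forms \<Longrightarrow> (\<lambda>m. s * c m) \<in> E_forms"
  by (auto simp: E_forms_def forms_eq form_poly_smult dvd_smult)

text \<open>Taking jets of length \<open>a i\<close> along the arcs is onto, by interpolation in
  degree \<open>d\<close>, and its kernel is \<open>E_forms\<close>.\<close>

lemma card_E_forms:
  "card (UNIV :: 'a set) ^ ((d + 2) choose 2) = card (UNIV :: 'a set) ^ (a 1 + a 2 + a 3) * card E_forms"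
proof -
  define K where "K = (SIGMA i:{1,2,3}. {..<a i})"
  define jets where "jets c = (\<lambda>x. if x \<in> K then coeff (form_poly d c (arc (fst x))) (snd x) else 0)"
    for c :: "nat \<times> nat \<times> nat \<Rightarrow> 'a"
  have fK: "finite K" and cK: "card K = a 1 + a 2 + a 3" by (simp_all add: K_def)
  let ?A = "{f :: nat \<times> nat \<Rightarrow> 'a. \<forall>x. x \<notin> K \<longrightarrow> f x = 0}"
  have "card (forms d :: (nat \<times> nat \<times> nat \<Rightarrow> 'a) set)
      = card (jets ` forms d) * card {c\<in>forms d. jets c = 0}"
  proof (rule card_additive_map)
    show "finite (forms d :: (nat \<times> nat \<times> nat \<Rightarrow> 'a) set)"
      unfolding forms_eq by (rule card_fun_support(1)[OF finite_mon_deg])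
    fix c c' :: "nat \<times> nat \<times> nat \<Rightarrow> 'a" assume "c \<in> forms d" "c' \<in> forms d"
    then show "c + c' \<in> forms d" "c - c' \<in> forms d" by (auto simp: forms_eq)
    have "form_poly d (c + c') g = form_poly d c g + form_poly d c' g" for g
      using form_poly_add[of d c c' g] by (simp only: plus_fun_def)
    then show "jets (c + c') = jets c + jets c'" by (simp add: jets_def fun_eq_iff)
  qed
  moreover have "jets ` forms d = ?A"
  proof (intro equalityI subsetI)
    fix f assume f: "f \<in> ?A"
    define r where "r i = (\<Sum>k<a i. monom (f (i,k)) k)" for i
    obtain F where "is_form d F" and F: "\<And>i. i \<in> {1,2,3} \<Longrightarrow> monom 1 (a i) dvd F (arc i) - r i"
      using interpolation[of d r] by auto
    then obtain c where c: "c \<in> forms d" "\<And>g. F g = form_poly d c g" by (auto simp: is_form_def)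
    have "jets c x = f x" for x
    proof (cases "x \<in> K")
      case True
      then obtain i k where x: "x = (i,k)" and i: "i \<in> {1,2,3}" "k < a i" unfolding K_def by blast
      have "coeff (F (arc i) - r i) k = 0" using F[OF i(1)] i(2) by (simp add: monom_1_dvd_iff')
      then show ?thesis using i(2) True by (simp add: jets_def x c r_def coeff_sum)
    next
      case False
      then have "f x = 0" using f by blast
      then show ?thesis using False by (simp add: jets_def)
    qed
    then have "f = jets c" by (simp add: fun_eq_iff)
    then show "f \<in> jets ` forms d" using c(1) by blast
  qed (auto simp: jets_def)
  moreover have "{c\<in>forms d. jets c = 0} = E_forms"
    unfolding E_forms_def
    by (intro Collect_cong conj_cong refl) (auto simp: jets_def fun_eq_iff monom_1_dvd_iff' K_def)
  ultimately show ?thesis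
    using card_fun_support(2)[OF fK, where 'a = 'a] card_fun_support(2)[OF finite_mon_deg[of d], where 'a = 'a]
    by (simp add: cK card_mon_deg forms_eq)
qed

end

section \<open>The code, its dimension and the words of least weight in its dual\<close>

locale herm_code_points = herm_triangle q ty u v w a d
  for q :: nat and ty :: "'a::{finite,field} itself" and u v w a d +
  fixes P :: "nat \<Rightarrow> 'a ppoint" and rep :: "'a ppoint \<Rightarrow> 'a vec3"
  assumes P_on: "i \<in> {1,2,3} \<Longrightarrow> P i \<in> herm_points q"
    and u_in: "i \<in> {1,2,3} \<Longrightarrow> u i \<in> P i"
    and rep_in: "Q \<in> herm_points q - {P 1, P 2, P 3} \<Longrightarrow> rep Q \<in> Q"
begin

definition B :: "'a ppoint set" where "B = herm_points q - {P 1, P 2, P 3}"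

definition code_word :: "(nat \<times> nat \<times> nat \<Rightarrow> 'a) \<Rightarrow> 'a ppoint \<Rightarrow> 'a" where
  "code_word c = (\<lambda>Q. if Q \<in> B then form_eval d c (rep Q) else 0)"

definition C :: "('a ppoint \<Rightarrow> 'a) set" where "C = code_word ` E_forms"

lemma P_proj: "i \<in> {1,2,3} \<Longrightarrow> P i \<in> proj_points"
  using P_on by (simp add: herm_points_def)

lemma u_iso: "i \<in> {1,2,3} \<Longrightarrow> herm q (u i) = 0"
  using iso by (simp add: herm_eq_dot3_tang)

lemma P_distinct: "i \<in> {1,2,3} \<Longrightarrow> j \<in> {1,2,3} \<Longrightarrow> i \<noteq> j \<Longrightarrow> P i \<noteq> P j"
proof
  assume i: "i \<in> {1,2,3}" and j: "j \<in> {1,2,3}" and "i \<noteq> j" "P i = P j"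
  then obtain k where "u j = scale3 k (u i)"
    using proj_points_memD(2)[OF P_proj[OF i] u_in[OF i]] u_in[OF j] mem_proj_class by metis
  then show False using sep[OF i j \<open>i \<noteq> j\<close>] iso[OF i] by (simp add: dot3_scale3)
qed

lemma B_props:
  assumes "Q \<in> B"
  shows "Q \<in> proj_points" "rep Q \<in> Q" "herm q (rep Q) = 0" "i \<in> {1,2,3} \<Longrightarrow> Q \<noteq> P i"
  using assms rep_in herm_points_iff by (auto simp: B_def herm_points_def)

lemma B_finite: "finite B"
  using card_herm_points unfolding B_def by (intro finite_Diff) (metis card.infinite add_is_0 one_neq_zero)

lemma card_B: "card B = q ^ 3 - 2"
proof -
  have "card {P 1, P 2, P 3} = 3"
    using P_distinct[of 1 2] P_distinct[of 1 3] P_distinct[of 2 3] by simp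
  moreover have "{P 1, P 2, P 3} \<subseteq> herm_points q" using P_on by auto
  ultimately show ?thesis unfolding B_def using card_herm_points by (subst card_Diff_subset) auto
qed

lemma B_off_tangent:
  assumes "Q \<in> B" "i \<in> {1,2,3}"
  shows "dot3 (tang q (u i)) (rep Q) \<noteq> 0"
  using isotropic_tang_nonzero[OF u_iso[OF assms(2)] B_props(3)[OF assms(1)]]
    distinct_points_cross3[OF P_proj[OF assms(2)] B_props(1)[OF assms(1)] _ u_in[OF assms(2)] B_props(2)[OF assms(1)]]
    B_props(4)[OF assms] by metis

lemma herm_code_eq: "herm_code q B rep d [(P 1, a 1), (P 2, a 2), (P 3, a 3)] = C"
proof -
  have "vanishes_on q d c (P i) (a i) \<longleftrightarrow> monom 1 (a i) dvd form_poly d c (arc i)" if i: "i \<in> {1,2,3}" for c i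
    by (rule vanishes_on_iff[OF P_proj[OF i] u_in[OF i] _ iso[OF i] tan[OF i] trans[OF i] basis[OF i]])
      (use a_bounds[OF i] d_bounds in linarith)
  then have "c \<in> forms d \<and> (\<forall>(P,a)\<in>set [(P 1, a 1), (P 2, a 2), (P 3, a 3)]. vanishes_on q d c P a)
      \<longleftrightarrow> c \<in> E_forms" for c
    by (simp add: E_forms_def)
  then show ?thesis unfolding herm_code_def C_def code_word_def by auto
qed

lemma code_word_inj: "inj_on code_word E_forms"
proof (rule inj_onI)
  fix c c' assume c: "c \<in> E_forms" "c' \<in> E_forms" and eq: "code_word c = code_word c'"
  define e where "e = (\<lambda>m. c m + (-1) * c' m)"
  have e: "e \<in> E_forms" unfolding e_def by (intro E_forms_add E_forms_smult c)
  have e0: "form_eval d e (rep Q) = 0" if "Q \<in> B" for Q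
    using fun_cong[OF eq, of Q] that unfolding e_def form_eval_add form_eval_smult
    by (simp add: code_word_def)
  \<comment> \<open>The abscissas of the three removed points, so that the other affine fibres lie
    entirely in \<open>B\<close>. For a point at infinity the division by zero yields
    \<open>0\<close>, which merely excludes one more fibre.\<close>
  define X0 where "X0 = (\<lambda>i. fst (u i) / snd (snd (u i))) ` {1,2,3}"
  have "card X0 \<le> card {1,2,3::nat}" unfolding X0_def by (rule card_image_le) simp
  then have "card X0 \<le> 3" by simp
  moreover have "6 * q \<le> q ^ 2" using d_bounds by (simp add: power2_eq_square)
  ultimately have X0: "card X0 + d < q ^ 2" using d_bounds by linarith
  have "e = (\<lambda>m. 0)"
  proof (rule form_vanishing_imp_zero[OF _ d_bounds(2) X0])
    show "e \<in> forms d" using e by (simp add: E_forms_def)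
    fix x y :: 'a assume x: "x \<notin> X0" and y: "y ^ q + y = x ^ (q + 1)"
    let ?z = "(x,y,1::'a)"
    define Q where "Q = proj_class ?z"
    have zQ: "?z \<in> Q" and Qp: "Q \<in> proj_points"
      unfolding Q_def by (rule proj_class_self, rule proj_class_in_proj_points) simp
    have "herm q ?z = 0" using y by (simp add: herm_def add.commute)
    then have "Q \<in> herm_points q" using herm_points_iff[OF Qp zQ] by simp
    moreover have "Q \<noteq> P i" if i: "i \<in> {1,2,3}" for i
    proof
      assume "Q = P i"
      then obtain k where k: "k \<noteq> 0" "u i = scale3 k ?z" using u_in[OF i] unfolding Q_def
        by (metis mem_proj_class)
      then have "x = fst (u i) / snd (snd (u i))" by simp
      then show False using x i unfolding X0_def by blast
    qed
    ultimately have QB: "Q \<in> B" by (auto simp: B_def)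
    then obtain k where "k \<noteq> 0" "rep Q = scale3 k ?z" using B_props(2) Q_def mem_proj_class by metis
    then show "form_eval d e ?z = 0" using e0[OF QB] by (simp add: form_eval_scale3 del: scale3.simps)
  qed
  then show "c = c'" unfolding e_def by (simp add: fun_eq_iff)
qed

lemma code_dim_C: "code_dim C = ((d + 2) choose 2) - a 1 - a 2 - a 3"
proof -
  let ?s = "\<lambda>s (f::'a ppoint \<Rightarrow> 'a) x. s * f x"
  interpret V: vector_space ?s by (rule vector_space_fun)
  have "V.subspace C"
  proof (rule V.subspaceI)
    have "(\<lambda>m. 0) \<in> E_forms" by (auto simp: E_forms_def forms_def form_poly_def)
    moreover have "code_word (\<lambda>m. 0) = 0" by (auto simp: code_word_def form_eval_def fun_eq_iff)
    ultimately show "0 \<in> C" unfolding C_def by (metis imageI)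
    fix f g assume "f \<in> C" "g \<in> C"
    then obtain c c' where c: "c \<in> E_forms" "c' \<in> E_forms" "f = code_word c" "g = code_word c'"
      by (auto simp: C_def)
    have "f + g = code_word (\<lambda>m. c m + c' m)" by (simp add: c code_word_def fun_eq_iff form_eval_add)
    then show "f + g \<in> C" using E_forms_add[OF c(1,2)] by (simp add: C_def)
  next
    fix s f assume "f \<in> C"
    then obtain c where c: "c \<in> E_forms" "f = code_word c" by (auto simp: C_def)
    have "(\<lambda>x. s * f x) = code_word (\<lambda>m. s * c m)" by (simp add: c code_word_def fun_eq_iff form_eval_smult)
    then show "(\<lambda>x. s * f x) \<in> C" using E_forms_smult[OF c(1)] by (simp add: C_def)
  qed
  moreover have "finite C"
    unfolding C_def E_forms_def forms_eq using card_fun_support(1)[OF finite_mon_deg] by simp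
  ultimately have "card C = card (UNIV :: 'a set) ^ V.dim C"
    by (intro card_subspace_eq_power_dim[OF vector_space_fun])
  moreover have "card C = card E_forms" unfolding C_def by (rule card_image[OF code_word_inj])
  ultimately have "card (UNIV :: 'a set) ^ ((d + 2) choose 2) = card (UNIV :: 'a set) ^ (a 1 + a 2 + a 3 + V.dim C)"
    using card_E_forms by (simp add: power_add)
  moreover have "1 < card (UNIV :: 'a set)" by (rule card_field_gt_1)
  ultimately have "(d + 2) choose 2 = a 1 + a 2 + a 3 + V.dim C" using power_inject_exp by blast
  then show ?thesis by (simp add: code_dim_def)
qed

lemma low_weight_dual:
  assumes f: "f \<in> dual_code B C" "f \<noteq> (\<lambda>_. 0)" "weight B f \<le> d"
  shows "card (supp B f) = d \<and>
    (\<exists>i\<in>{1,2,3}. \<exists>j\<in>{1,2,3}. i \<noteq> j \<and> (\<forall>Q\<in>supp B f. det3 (u i) (u j) (rep Q) = 0))"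
proof -
  have sub: "supp B f \<subseteq> B" by (auto simp: supp_def)
  interpret herm_relation q ty u v w a d "supp B f" rep f
  proof
    show "finite (supp B f)" using sub B_finite finite_subset by blast
    show "supp B f \<noteq> {}" using f by (auto simp: supp_def dual_code_def fun_eq_iff)
    show "card (supp B f) \<le> d" using f by (simp add: weight_def)
    show "f x \<noteq> 0" if "x \<in> supp B f" for x using that by (simp add: supp_def)
    show "dot3 (tang q (u i)) (rep x) \<noteq> 0" if "x \<in> supp B f" "i \<in> {1,2,3}" for x i
      using that sub B_off_tangent by blast
    show "cross3 (rep x) (rep y) \<noteq> (0,0,0)" if "x \<in> supp B f" "y \<in> supp B f" "x \<noteq> y" for x y
      using that sub by (intro distinct_points_cross3[of x y] B_props) auto
    fix c assume "c \<in> E_forms"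
    then have "(\<Sum>Q\<in>B. f Q * code_word c Q) = 0" using f by (auto simp: dual_code_def C_def)
    moreover have "(\<Sum>Q\<in>B. f Q * code_word c Q) = (\<Sum>Q\<in>supp B f. f Q * form_eval d c (rep Q))"
      by (rule sum.mono_neutral_cong_right) (auto simp: B_finite supp_def code_word_def)
    ultimately show "(\<Sum>Q\<in>supp B f. f Q * form_eval d c (rep Q)) = 0" by simp
  qed
  show ?thesis by (rule S_on_side)
qed

text \<open>On the line through \<open>u 1\<close> and \<open>u 2\<close> the forms of the code have only \<open>d - 1\<close> free coefficients.\<close>

lemma dual_word_exists: "\<exists>f\<in>dual_code B C. f \<noteq> (\<lambda>_. 0) \<and> weight B f \<le> d"
proof -
  let ?z = "\<lambda>t. plus3 (scale3 t (u 1)) (u 2)"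
  have P12: "cross3 (u 1) (u 2) \<noteq> (0,0,0)"
    using distinct_points_cross3[OF P_proj[of 1] P_proj[of 2] P_distinct[of 1 2]] u_in by simp
  \<comment> \<open>The side has \<open>q - 1\<close> points of the curve besides its two vertices,
    and \<open>d\<close> is at most \<open>q - 1\<close>.\<close>
  have "d \<le> card {t. t \<noteq> 0 \<and> herm q (?z t) = 0}"
    using card_secant[OF u_iso[of 1] u_iso[of 2] P12] d_bounds by simp
  then obtain T where T: "T \<subseteq> {t. t \<noteq> 0 \<and> herm q (?z t) = 0}" "card T = d" "finite T"
    by (rule obtain_subset_with_card_n) (rule that)
  define pt where "pt t = proj_class (?z t)" for t
  have z0: "?z t \<noteq> (0,0,0)" for t
  proof
    assume eq: "?z t = (0,0,0)"
    have "det3 (u 1) (?z t) (u 3) = det3 (u 1) (u 2) (u 3)" by (simp add: det3_plus3 det3_scale3)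
    then show False using indep eq by (metis det3_eq_dot3_cross3 det3_rotate dot3_commute dot3_zero_left)
  qed
  have ptp: "pt t \<in> proj_points" "?z t \<in> pt t" for t
    unfolding pt_def by (rule proj_class_in_proj_points[OF z0], rule proj_class_self)
  have ptB: "pt t \<in> B" if t: "t \<in> T" for t
  proof -
    have "pt t \<in> herm_points q" using herm_points_iff[OF ptp] t T by blast
    moreover have "pt t \<noteq> P i" if i: "i \<in> {1,2,3}" for i
    proof
      assume "pt t = P i"
      then obtain k where k: "k \<noteq> 0" "u i = scale3 k (?z t)" using u_in[OF i] unfolding pt_def
        by (metis mem_proj_class)
      have "t \<noteq> 0" using t T by blast
      consider "i = 1" | "i = 2" | "i = 3" using i by auto
      then show False
      proof cases
        case 1
        have "det3 (u 1) (u i) (u 3) = k * det3 (u 1) (u 2) (u 3)" by (simp add: k det3_plus3 det3_scale3)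
        then show False using 1 k indep by simp
      next
        case 2
        have "det3 (u i) (u 2) (u 3) = k * t * det3 (u 1) (u 2) (u 3)" by (simp add: k det3_plus3 det3_scale3)
        then show False using 2 k indep \<open>t \<noteq> 0\<close> by simp
      next
        case 3
        have "det3 (u 1) (u 2) (u i) = 0" by (simp add: k det3_plus3 det3_scale3)
        then show False using 3 indep by simp
      qed
    qed
    ultimately show ?thesis by (auto simp: B_def)
  qed
  have "inj_on pt T"
  proof (rule inj_onI)
    fix s t assume "pt s = pt t"
    then obtain k where k: "?z s = scale3 k (?z t)" using ptp(2)[of s] unfolding pt_def by (metis mem_proj_class)
    have "det3 (u 1) (?z s) (u 3) = det3 (u 1) (u 2) (u 3)" "det3 (u 1) (?z t) (u 3) = det3 (u 1) (u 2) (u 3)"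
      by (simp_all add: det3_plus3 det3_scale3)
    then have "k = 1" using k indep by (simp add: det3_scale3)
    then have "?z s = ?z t" using k by (metis scale3_one)
    moreover have "det3 (?z s) (u 2) (u 3) = s * det3 (u 1) (u 2) (u 3)"
      "det3 (?z t) (u 2) (u 3) = t * det3 (u 1) (u 2) (u 3)"
      by (simp_all add: det3_plus3 det3_scale3)
    ultimately have "s * det3 (u 1) (u 2) (u 3) = t * det3 (u 1) (u 2) (u 3)" by metis
    then show "s = t" using indep by simp
  qed
  have "\<exists>k. rep (pt t) = scale3 k (?z t)" if "t \<in> T" for t
    using B_props(2)[OF ptB[OF that]] pt_def mem_proj_class by metis
  then obtain k where k: "\<And>t. t \<in> T \<Longrightarrow> rep (pt t) = scale3 (k t) (?z t)" by metis
  define A where "A = {f :: 'a \<Rightarrow> 'a. \<forall>t. t \<notin> T \<longrightarrow> f t = 0}"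
  \<comment> \<open>The exponents \<open>1\<close> to \<open>d - 1\<close> are those surviving in a
    form that vanishes at \<open>u 1\<close> and \<open>u 2\<close>; the factor
    \<open>k t ^ d\<close> accounts for the prescribed representative of
    \<open>pt t\<close>.\<close>
  define mom where "mom f = (\<lambda>j. if j \<in> {1..<d} then \<Sum>t\<in>T. f t * (k t) ^ d * t ^ j else 0)" for f :: "'a \<Rightarrow> 'a"
  have "card A = card (mom ` A) * card {f\<in>A. mom f = 0}"
  proof (rule card_additive_map)
    show "finite A" unfolding A_def by (rule card_fun_support(1)[OF T(3)])
  qed (auto simp: A_def mom_def fun_eq_iff sum.distrib algebra_simps)
  moreover have "card (mom ` A) \<le> card {f :: nat \<Rightarrow> 'a. \<forall>x. x \<notin> {1..<d} \<longrightarrow> f x = 0}"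
    by (rule card_mono[OF card_fun_support(1)]) (auto simp: mom_def)
  then have "card (mom ` A) \<le> card (UNIV :: 'a set) ^ (d - 1)"
    using card_fun_support(2)[of "{1..<d}", where 'a = 'a] by (simp only: card_atLeastLessThan finite_atLeastLessThan)
  moreover have "card A = card (UNIV :: 'a set) ^ d"
    unfolding A_def using T by (simp add: card_fun_support(2))
  moreover have "card (UNIV :: 'a set) ^ (d - 1) < card (UNIV :: 'a set) ^ d"
    using card_field_gt_1 d_bounds by (intro power_strict_increasing) auto
  \<comment> \<open>There are \<open>d\<close> unknown values against \<open>d - 1\<close> moment
    conditions.\<close>
  ultimately have "card {f\<in>A. mom f = 0} \<noteq> 1" by auto
  moreover have "0 \<in> {f\<in>A. mom f = 0}" by (auto simp: A_def mom_def fun_eq_iff)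
  ultimately obtain g where g: "g \<in> A" "mom g = 0" "g \<noteq> 0"
    by (metis (mono_tags, lifting) is_singletonI' is_singleton_altdef empty_iff mem_Collect_eq)
  define f where "f Q = (if Q \<in> pt ` T then g (inv_into T pt Q) else 0)" for Q
  have fpt: "f (pt t) = g t" if "t \<in> T" for t using that \<open>inj_on pt T\<close> by (simp add: f_def)
  have "f \<in> dual_code B C"
    unfolding dual_code_def
  proof (intro CollectI conjI allI impI ballI)
    fix Q assume "Q \<notin> B" then show "f Q = 0" using ptB by (auto simp: f_def)
  next
    fix h assume "h \<in> C"
    then obtain c where c: "c \<in> E_forms" "h = code_word c" by (auto simp: C_def)
    define p where "p = form_poly d c (arc3 (u 2) (u 1))"
    have u0: "form_eval d c (u i) = 0" if i: "i \<in> {1,2,3}" for i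
    proof -
      have "coeff (form_poly d c (arc i)) 0 = 0"
        using c(1) i a_bounds[OF i] unfolding E_forms_def by (auto simp: monom_1_dvd_iff')
      then have "form_eval d c (plus3 (scale3 0 (v i)) (u i)) = 0"
        by (simp add: poly_form_poly_arc3[symmetric] poly_0_coeff_0)
      then show ?thesis by (cases "u i"; cases "v i") simp
    qed
    \<comment> \<open>The top coefficient is the value at \<open>u 1\<close> and the constant one
      the value at \<open>u 2\<close>; both vanish since \<open>a 1\<close> and \<open>a 2\<close>
      are positive.\<close>
    have pd: "degree p \<le> d" "coeff p d = 0" 
      using form_poly_arc3_top[of d c "u 2" "u 1"] u0[of 1] by (simp_all add: p_def)
    have pz: "poly p t = form_eval d c (?z t)" for t by (simp add: p_def poly_form_poly_arc3)
    have "form_eval d c (u 2) = poly p 0" unfolding pz by (cases "u 1"; cases "u 2") simp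
    then have p0: "coeff p 0 = 0" using u0[of 2] by (simp add: poly_0_coeff_0)
    have pt_sum: "poly p t = (\<Sum>j\<in>{1..<d}. coeff p j * t ^ j)" for t
    proof -
      have "poly p t = (\<Sum>j\<le>d. coeff p j * t ^ j)" 
        unfolding poly_altdef by (rule sum.mono_neutral_left) (use pd(1) in \<open>auto simp: coeff_eq_0\<close>)
      also have "\<dots> = (\<Sum>j\<in>{1..<d}. coeff p j * t ^ j)"
      proof (rule sum.mono_neutral_right)
        show "\<forall>j\<in>{..d} - {1..<d}. coeff p j * t ^ j = 0"
        proof
          fix j assume "j \<in> {..d} - {1..<d}"
          then have "j = 0 \<or> j = d" by auto
          then show "coeff p j * t ^ j = 0" using p0 pd(2) by auto
        qed
      qed auto
      finally show ?thesis .
    qed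
    have "(\<Sum>Q\<in>B. f Q * h Q) = (\<Sum>Q\<in>pt ` T. f Q * h Q)"
      by (rule sum.mono_neutral_right) (use ptB B_finite in \<open>auto simp: f_def\<close>)
    also have "\<dots> = (\<Sum>t\<in>T. f (pt t) * h (pt t))" by (rule sum.reindex_cong[OF \<open>inj_on pt T\<close>]) auto
    also have "\<dots> = (\<Sum>t\<in>T. \<Sum>j\<in>{1..<d}. coeff p j * (g t * k t ^ d * t ^ j))"
    proof (rule sum.cong[OF refl])
      fix t assume t: "t \<in> T"
      have "h (pt t) = k t ^ d * poly p t"
        using ptB[OF t] by (simp add: c code_word_def k[OF t] form_eval_scale3 pz)
      then show "f (pt t) * h (pt t) = (\<Sum>j\<in>{1..<d}. coeff p j * (g t * k t ^ d * t ^ j))"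
        unfolding fpt[OF t] pt_sum by (simp add: sum_distrib_left mult_ac)
    qed
    also have "\<dots> = (\<Sum>j\<in>{1..<d}. coeff p j * mom g j)"
      by (subst sum.swap) (simp add: mom_def sum_distrib_left)
    also have "\<dots> = 0" by (simp add: g)
    finally show "(\<Sum>Q\<in>B. f Q * h Q) = 0" .
  qed
  moreover have "f \<noteq> (\<lambda>_. 0)"
  proof
    assume f0: "f = (\<lambda>_. 0)"
    have "g t = 0" for t
    proof (cases "t \<in> T")
      case True
      then show ?thesis using fpt[OF True] f0 by simp
    qed (use g in \<open>simp add: A_def\<close>)
    then show False using g(3) by (simp add: fun_eq_iff)
  qed
  moreover have "supp B f \<subseteq> pt ` T" by (auto simp: supp_def f_def)
  then have "weight B f \<le> d"
    unfolding weight_def using card_mono[OF _ \<open>supp B f \<subseteq> pt ` T\<close>] card_image_le[OF T(3), of pt] T by auto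
  ultimately show ?thesis by blast
qed

text \<open>A nonzero dual word of weight at most \<open>d\<close> has weight exactly
  \<open>d\<close>, so the upper bound in \<open>dual_word_exists\<close> also settles the attained
  value.\<close>

lemma min_distance_dual: "min_distance B (dual_code B C) = d"
  unfolding min_distance_def
proof (rule Least_equality)
  show "\<exists>f\<in>dual_code B C. f \<noteq> (\<lambda>_. 0) \<and> weight B f = d"
    using dual_word_exists low_weight_dual by (metis weight_def)
  fix n assume "\<exists>f\<in>dual_code B C. f \<noteq> (\<lambda>_. 0) \<and> weight B f = n"
  then obtain f where f: "f \<in> dual_code B C" "f \<noteq> (\<lambda>_. 0)" "weight B f = n" by blast
  then show "d \<le> n" using low_weight_dual[OF f(1,2)] by (cases "n \<le> d") (auto simp: weight_def)
qed

lemma min_weight_support: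
  assumes f: "f \<in> dual_code B C" "f \<noteq> (\<lambda>_. 0)" "weight B f = d"
  shows "supp B f \<subseteq> line_through (P 2) (P 3) \<or> supp B f \<subseteq> line_through (P 1) (P 3)
    \<or> supp B f \<subseteq> line_through (P 1) (P 2)"
proof -
  obtain i j where ij: "i \<in> {1,2,3}" "j \<in> {1,2,3}" "i \<noteq> j"
    and det: "\<And>Q. Q \<in> supp B f \<Longrightarrow> det3 (u i) (u j) (rep Q) = 0"
    using low_weight_dual[OF f(1,2)] f(3) order_refl by metis
  have "Q \<in> line_through (P i) (P j) \<and> Q \<in> line_through (P j) (P i)" if Q: "Q \<in> supp B f" for Q
  proof -
    have QB: "Q \<in> B" using Q by (simp add: supp_def)
    note col = collinear3_iff[OF P_proj P_proj B_props(1)[OF QB] u_in u_in B_props(2)[OF QB]]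
    show ?thesis using col[of i j] col[of j i] ij det[OF Q] det3_swap[of "u j" "u i"] B_props(1)[OF QB]
      by (simp add: line_through_def)
  qed
  then have "supp B f \<subseteq> line_through (P i) (P j)" "supp B f \<subseteq> line_through (P j) (P i)" by blast+
  then show ?thesis using ij by auto
qed

end

text \<open>The tangent at \<open>x\<close> meets the line through \<open>y\<close> and
  \<open>z\<close> in \<open>v\<close>. The coefficient of \<open>z\<close> in \<open>v\<close> is
  nonzero because \<open>y\<close> is off the tangent, so \<open>x\<close>, \<open>v\<close>,
  \<open>y\<close> is again a frame.\<close>

lemma (in hermitian_field) tangent_direction:
  fixes x y z :: "'a vec3"
  assumes "det3 x y z \<noteq> 0" "dot3 (tang q x) y \<noteq> 0"
  shows "\<exists>v. dot3 (tang q x) v = 0 \<and> det3 x v y \<noteq> 0"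
proof -
  define v where "v = plus3 (scale3 (dot3 (tang q x) z) y) (scale3 (- dot3 (tang q x) y) z)"
  have "dot3 (tang q x) v = 0" by (simp add: v_def dot3_plus3 dot3_scale3)
  moreover have "det3 x z y = - det3 x y z" by (metis det3_rotate det3_swap)
  then have "det3 x v y \<noteq> 0" using assms by (simp add: v_def det3_plus3 det3_scale3)
  ultimately show ?thesis by blast
qed

theorem theorem4p1:
  fixes q d a1 a2 a3 :: nat
    and P1 P2 P3 :: "('a::{finite,field}) ppoint"
    and rep :: "'a ppoint \<Rightarrow> 'a \<times> 'a \<times> 'a"
  assumes q_pp: "\<exists>p m. prime p \<and> m \<ge> 1 \<and> q = p ^ m"
    and card_F: "card (UNIV :: 'a set) = q ^ 2"
    and P_on: "P1 \<in> herm_points q" "P2 \<in> herm_points q" "P3 \<in> herm_points q"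
    and P_dist: "P1 \<noteq> P2" "P1 \<noteq> P3" "P2 \<noteq> P3"
    and noncoll: "\<not> collinear3 P1 P2 P3"
    and d_ge: "d \<ge> 5" and d_range: "1 \<le> d" "d \<le> q - 1"
    and a_range: "a1 \<in> {1..d}" "a2 \<in> {1..d}" "a3 \<in> {1..d}"
    and a_sum: "a1 + a2 + a3 \<le> 3 * d - 5"
    and a_d: "card {i \<in> {1::nat,2,3}. [a1,a2,a3] ! (i - 1) = d} \<le> 1"
    and rep: "\<forall>Q \<in> herm_points q - {P1,P2,P3}. rep Q \<in> Q"
  shows "let B = herm_points q - {P1,P2,P3};
             C = herm_code q B rep d [(P1,a1),(P2,a2),(P3,a3)];
             D = dual_code B C;
             L = (\<lambda>i::nat. if i = 1 then line_through P2 P3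
                          else if i = 2 then line_through P1 P3 else line_through P1 P2)
         in card B = q ^ 3 - 2
          \<and> code_dim C = (d + 2 choose 2) - a1 - a2 - a3
          \<and> min_distance B D = d
          \<and> (\<forall>w\<in>D. w \<noteq> (\<lambda>_. 0) \<longrightarrow>
               (weight B w = d \<longleftrightarrow>
                 (\<exists>i\<in>{1,2,3}. supp B w \<subseteq> B \<inter> L i \<and> card (supp B w) = d)))"
proof -
  interpret hermitian_field q "TYPE('a)" by unfold_locales (rule q_pp, rule card_F)
  define P where "P i = [P1,P2,P3] ! (i - 1)" for i
  define a where "a i = [a1,a2,a3] ! (i - 1)" for i
  have P123: "P 1 = P1" "P 2 = P2" "P 3 = P3" and a123: "a 1 = a1" "a 2 = a2" "a 3 = a3"
    by (simp_all add: P_def a_def)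
  have Pon: "P i \<in> herm_points q" if "i \<in> {1,2,3}" for i using that P_on P123 by auto
  then have Pp: "P i \<in> proj_points" if "i \<in> {1,2,3}" for i using that by (simp add: herm_points_def)
  then have "\<exists>x. x \<in> P i" if "i \<in> {1,2,3}" for i using that proj_points_nonempty by blast
  then obtain u where u: "\<And>i. i \<in> {1,2,3} \<Longrightarrow> u i \<in> P i" by metis
  have iso: "herm q (u i) = 0" if "i \<in> {1,2,3}" for i
    using herm_points_iff[OF Pp u] Pon that by blast
  have Pd: "P i \<noteq> P j" if "i \<in> {1,2,3}" "j \<in> {1,2,3}" "i \<noteq> j" for i j
    using that P_dist P123 by auto
  have sep: "dot3 (tang q (u i)) (u j) \<noteq> 0" if "i \<in> {1,2,3}" "j \<in> {1,2,3}" "i \<noteq> j" for i j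
    using isotropic_tang_nonzero[OF iso iso distinct_points_cross3[OF Pp Pp Pd u u]] that by blast
  have ind: "det3 (u 1) (u 2) (u 3) \<noteq> 0"
    using noncoll collinear3_iff[OF Pp Pp Pp u u u, of 1 2 3] unfolding P123 by simp
  have "\<exists>v w. dot3 (tang q (u i)) v = 0 \<and> dot3 (tang q (u i)) w \<noteq> 0 \<and> det3 (u i) v w \<noteq> 0"
    if i: "i \<in> {1,2,3}" for i
  proof -
    \<comment> \<open>The next vertex in cyclic order serves as the point off the tangent at
      \<open>u i\<close>.\<close>
    have "\<exists>j\<in>{1,2,3}. \<exists>k. i \<noteq> j \<and> det3 (u i) (u j) (u k) \<noteq> 0"
    proof -
      consider "i = 1" | "i = 2" | "i = 3" using i by auto
      then show ?thesis
      proof cases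
        case 1 then show ?thesis using ind by (intro bexI[of _ 2] exI[of _ 3]) auto
      next
        case 2 then show ?thesis using ind det3_rotate[of "u 1" "u 2" "u 3"]
          by (intro bexI[of _ 3] exI[of _ 1]) auto
      next
        case 3 then show ?thesis using ind det3_rotate[of "u 3" "u 1" "u 2"]
          by (intro bexI[of _ 1] exI[of _ 2]) auto
      qed
    qed
    then obtain j k where j: "j \<in> {1,2,3}" "i \<noteq> j" "det3 (u i) (u j) (u k) \<noteq> 0" by blast
    then show ?thesis using tangent_direction[OF j(3) sep[OF i j(1,2)]] sep[OF i j(1,2)] by blast
  qed
  then obtain v w where vw: "\<And>i. i \<in> {1,2,3} \<Longrightarrow>
      dot3 (tang q (u i)) (v i) = 0 \<and> dot3 (tang q (u i)) (w i) \<noteq> 0 \<and> det3 (u i) (v i) (w i) \<noteq> 0"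
    by metis
  have a_bnd: "1 \<le> a i \<and> a i \<le> d" if "i \<in> {1,2,3}" for i using that a_range a123 by auto
  have a_mx: "a j \<noteq> d" if "i \<in> {1,2,3}" "j \<in> {1,2,3}" "i \<noteq> j" "a i = d" for i j
  proof
    assume "a j = d"
    then have "{i,j} \<subseteq> {i \<in> {1::nat,2,3}. [a1,a2,a3] ! (i - 1) = d}"
      using that unfolding a_def by blast
    then have "card {i,j} \<le> card {i \<in> {1::nat,2,3}. [a1,a2,a3] ! (i - 1) = d}"
      by (rule card_mono[rotated]) simp
    then have "card {i,j} \<le> 1" using a_d by (rule order_trans)
    then show False using that by simp
  qed
  interpret herm_code_points q "TYPE('a)" u v w a d P rep
  proof
    show "5 \<le> d" "d < q" using d_ge d_range by auto
    show "a 1 + a 2 + a 3 + 5 \<le> 3 * d" using a_sum d_ge unfolding a123 by simp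
    show "rep Q \<in> Q" if "Q \<in> herm_points q - {P 1, P 2, P 3}" for Q
      using that rep unfolding P123 by blast
  qed (fact iso[unfolded herm_eq_dot3_tang] sep ind a_bnd a_mx Pon u | use vw in blast)+
  have B: "herm_points q - {P1,P2,P3} = B" unfolding B_def P123 ..
  have C: "herm_code q B rep d [(P1,a1),(P2,a2),(P3,a3)] = C" using herm_code_eq unfolding P123 a123 .
  have sides: "\<exists>i\<in>{1,2,3}. supp B f \<subseteq> B \<inter> (if i = (1::nat) then line_through P2 P3
      else if i = 2 then line_through P1 P3 else line_through P1 P2) \<and> card (supp B f) = d"
    if "f \<in> dual_code B C" "f \<noteq> (\<lambda>_. 0)" "weight B f = d" for f
  proof -
    have "supp B f \<subseteq> B" by (auto simp: supp_def)
    then show ?thesis using min_weight_support[OF that] that(3) unfolding P123 weight_def by auto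
  qed
  \<comment> \<open>Geometry enters the equivalence only through \<open>sides\<close>; its converse
    is the definition of \<open>weight\<close>.\<close>
  show ?thesis
    unfolding Let_def B C using card_B code_dim_C[unfolded a123] min_distance_dual sides
    by (auto simp: weight_def)
qed

end
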